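(* Let $\mu\in\mathbb{C}$ with $\operatorname{Re}\mu<1/2$, and let $a=\{a_n\}_{n\in\mathbb{N}}$ be a complex sequence with $\sum_{n=1}^\infty |a_n|<\infty$. Then for every $n\in\mathbb{N}$, $$a_n=\frac{n}{\pi}\sinh(\pi n)\,\Gamma\!\left(\tfrac12+in-\mu\right)\Gamma\!\left(\tfrac12-in-\mu\right)\int_1^\infty P^\mu_{in-1/2}(x,\pi)\sum_{m=1}^\infty a_m P^\mu_{im-1/2}(x)\,dx,$$ where the iterated series and integral converge absolutely.
   Context: $\Gamma$ is Euler's gamma function and $i$ the imaginary unit. For $x>1$, $P^\mu_\nu(x)$ is the associated Legendre function (of the first kind), i.e. the analytic continuation to $x>1$ of $P^\mu_\nu(z)=\frac{1}{\Gamma(1-\mu)}\left(\frac{z+1}{z-1}\right)^{\mu/2}{}_2F_1\!\left(-\nu,1+\nu;1-\mu;\frac{1-z}{2}\right)$ ($|1-z|<2$), ${}_2F_1$ the Gauss hypergeometric function; equivalently, for $\operatorname{Re}\mu<1/2$ and $x=\cosh\alpha$, $\alpha>0$, $P^\mu_\nu(\cosh\alpha)=\sqrt{2/\pi}\,\frac{(\sinh\alpha)^\mu}{\Gamma(1/2-\mu)}\int_0^\alpha\frac{\cosh(t(\nu+1/2))}{(\cosh\alpha-\cosh t)^{1/2+\mu}}dt$. The incomplete Legendre integral is defined for $z>1$, $\omega>0$ by $$P^\mu_\nu(z,\omega)=\sqrt{\tfrac{2}{\pi}}\,\frac{\Gamma(1/2-\mu)(z^2-1)^{-\mu/2}}{\Gamma(1+\nu-\mu)\Gamma(-\nu-\mu)}\int_0^\omega\frac{\cosh(t(\nu+1/2))}{(\cosh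 t+z)^{1/2-\mu}}\,dt,$$ with powers of positive numbers taken with principal values; here it is used with $\nu=in-1/2$, $\omega=\pi$. *)

theory Defs
  imports "HOL-Analysis.Analysis"
begin

text \<open>Associated Legendre function of the first kind P^mu_nu(x) for x > 1, given by
  its integral representation, valid for Re mu < 1/2 (the only regime used):
  with x = cosh alpha, alpha > 0,
  P^mu_nu(cosh alpha) = sqrt(2/pi) (sinh alpha)^mu / Gamma(1/2-mu)
     * int_0^alpha cosh(t(nu+1/2)) / (cosh alpha - cosh t)^(1/2+mu) dt.
  Powers of positive reals are principal values (complex powr).\<close>
definition legendreP :: "complex \<Rightarrow> complex \<Rightarrow> real \<Rightarrow> complex" where
  "legendreP \<mu> \<nu> x =
     (let \<alpha> = arcosh x in
       complex_of_real (sqrt (2 / pi)) * (complex_of_real (sinh \<alpha>)) powr \<mu> / Gamma (1/2 - \<mu>) *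
       integral {0..\<alpha>} (\<lambda>t. cosh (complex_of_real t * (\<nu> + 1/2)) /
                               (complex_of_real (cosh \<alpha> - cosh t)) powr (1/2 + \<mu>)))"

definition legendreP_inc :: "complex \<Rightarrow> complex \<Rightarrow> real \<Rightarrow> real \<Rightarrow> complex" where
  "legendreP_inc \<mu> \<nu> z \<omega> =
     complex_of_real (sqrt (2 / pi)) * Gamma (1/2 - \<mu>) * (complex_of_real (z^2 - 1)) powr (- \<mu> / 2)
       / (Gamma (1 + \<nu> - \<mu>) * Gamma (- \<nu> - \<mu>)) *
     integral {0..\<omega>} (\<lambda>t. cosh (complex_of_real t * (\<nu> + 1/2)) /
                             (complex_of_real (cosh t + z)) powr (1/2 - \<mu>))"

end

theory Submission
  imports Defs "HOL-Real_Asymp.Real_Asymp" "HOL-Complex_Analysis.Cauchy_Integral_Theorem"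
begin

text \<open>
  Up to Gamma factors the product of \<open>P(x, \<pi>)\<close> (index n) and \<open>P(x)\<close> (index m) is
  A(x) B(x), where A(x) is the integral of \<open>cos (n t) (x + cosh t)\<close>^(\<open>\<mu>\<close> - 1/2) over [0, \<open>\<pi>\<close>] and
  B(x) that of \<open>cos (m s) (x - cosh s)\<close>^(-1/2 - \<open>\<mu>\<close>) over [0, arcosh x]; the powers of \<open>x\<^sup>2 - 1\<close> cancel.
  As it stands the triple integral over (x, t, s) diverges logarithmically at \<open>x = \<infinity>\<close>. Integrating A by
  parts in t lowers the exponent of \<open>x + cosh t\<close> to \<open>\<mu>\<close> - 3/2, after which everything converges
  absolutely, the x-integral is elementary and equals 1 / ((1/2 - \<open>\<mu>\<close>)(cosh t + cosh s)), and one is left with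
  the Fourier integral of sinh t / (cosh t + cosh s) over \<open>s > 0\<close>, namely \<open>\<pi>\<close> sin (m t) / sinh (\<open>\<pi>\<close> m).
  Orthogonality of the functions sin (m t) on [0, \<open>\<pi>\<close>] then isolates the coefficient with \<open>m = n\<close>.

  The Fourier integral is computed by writing sinh t / (cosh t + cosh s) as a convolution of the logistic
  density k(s) = e^s / (1 + e^s)^2 with the indicator of [-t, t]; the Fourier transform of k at y is
  \<open>\<Gamma>(1 + i y) \<Gamma>(1 - i y)\<close>.
\<close>

section \<open>Fourier transform of the logistic density\<close>

text \<open>Nonnegativity makes integrability a conclusion rather than a premise, so an explicit
  antiderivative with limits at both ends settles each of the next three integrals.\<close>

lemma has_bochner_integral_FTC_UNIV_nonneg:
  fixes f F :: "real \<Rightarrow> real"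
  assumes F: "\<And>x. (F has_real_derivative f x) (at x)"
    and f: "continuous_on UNIV f" "\<And>x. 0 \<le> f x"
    and lim: "(F \<longlongrightarrow> A) at_bot" "(F \<longlongrightarrow> B) at_top"
  shows "has_bochner_integral lborel f (B - A)"
proof -
  have c: "isCont f x" for x
    using f(1) by (simp add: continuous_on_eq_continuous_at)
  have l: "((F \<circ> real_of_ereal) \<longlongrightarrow> A) (at_right (-\<infinity>))"
          "((F \<circ> real_of_ereal) \<longlongrightarrow> B) (at_left \<infinity>)"
    using lim by (simp_all add: ereal_tendsto_simps)
  have "set_integrable lborel (einterval (-\<infinity>) \<infinity>) f" "(LBINT x=-\<infinity>..\<infinity>. f x) = B - A"
    by (rule interval_integral_FTC_nonneg[where F = F]; use F c f l in simp)+
  then show ?thesis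
    by (simp add: has_bochner_integral_iff interval_lebesgue_integral_def
        set_integrable_def set_lebesgue_integral_def)
qed

text \<open>This is Euler's integral for \<open>Gamma 1\<close> after the substitution
  \<open>u = exp s\<close>; it serves as the majorant of the oscillating integrand for
  \<open>Gamma (1 + \<i> * y)\<close>.\<close>

lemma has_bochner_integral_exp_minus_exp:
  "has_bochner_integral lborel (\<lambda>s::real. exp (s - exp s)) 1"
proof -
  have "has_bochner_integral lborel (\<lambda>s::real. exp (s - exp s)) (0 - (-1))"
  proof (rule has_bochner_integral_FTC_UNIV_nonneg)
    show "((\<lambda>s. - exp (- exp s)) has_real_derivative exp (s - exp s)) (at s)" for s :: real
      by (auto intro!: derivative_eq_intros simp flip: exp_add)
  qed (auto intro!: continuous_intros, real_asymp+)
  then show ?thesis by simp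
qed

text \<open>With \<open>u = exp r\<close> this is the integral of \<open>u * exp (- c * u)\<close>
  over the half-line. It is used with \<open>c = 1 + exp s\<close>, which produces the denominator
  of the logistic density.\<close>

lemma has_bochner_integral_exp_double_minus_exp:
  fixes c :: real
  assumes "c > 0"
  shows "has_bochner_integral lborel (\<lambda>r. exp (2 * r - c * exp r)) (1 / c\<^sup>2)"
proof -
  have "has_bochner_integral lborel (\<lambda>r::real. exp (2 * r - c * exp r)) (0 - (- (1 / c\<^sup>2)))"
  proof (rule has_bochner_integral_FTC_UNIV_nonneg)
    show "((\<lambda>r. - (exp r / c + 1 / c\<^sup>2) * exp (- c * exp r)) has_real_derivative
            exp (2 * r - c * exp r)) (at r)" for r :: real
      using assms exp_double[of r]
      by (auto intro!: derivative_eq_intros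
          simp: field_simps power2_eq_square exp_diff exp_minus)
    show "((\<lambda>r. - (exp r / c + 1 / c\<^sup>2) * exp (- c * exp r)) \<longlongrightarrow> - (1 / c\<^sup>2)) at_bot"
      using assms by real_asymp
    show "((\<lambda>r. - (exp r / c + 1 / c\<^sup>2) * exp (- c * exp r)) \<longlongrightarrow> 0) at_top"
      using assms by real_asymp
  qed (auto intro!: continuous_intros)
  then show ?thesis by simp
qed

text \<open>The antiderivative is the logistic function, which rises from 0 to 1.\<close>

lemma has_bochner_integral_logistic_deriv:
  "has_bochner_integral lborel (\<lambda>s::real. exp s / (1 + exp s)\<^sup>2) 1"
proof -
  have nz: "1 + exp s \<noteq> 0" for s :: real
    by (smt (verit) exp_gt_zero)
  have "has_bochner_integral lborel (\<lambda>s::real. exp s / (1 + exp s)\<^sup>2) (1 - 0)"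
  proof (rule has_bochner_integral_FTC_UNIV_nonneg)
    show "((\<lambda>s. exp s / (1 + exp s)) has_real_derivative exp s / (1 + exp s)\<^sup>2) (at s)" for s :: real
      using nz[of s] by (auto intro!: derivative_eq_intros simp: field_simps power2_eq_square)
    show "((\<lambda>s::real. exp s / (1 + exp s)) \<longlongrightarrow> 0) at_bot" by real_asymp
    show "((\<lambda>s::real. exp s / (1 + exp s)) \<longlongrightarrow> 1) at_top" by real_asymp
  qed (auto intro!: continuous_intros simp: nz)
  then show ?thesis by simp
qed

text \<open>Substituting \<open>exp s\<close> for the variable in Euler's integral turns its power
  with exponent \<open>\<i> * y\<close> into the phase \<open>cis (y * s)\<close>, and the Jacobian
  supplies the factor \<open>exp s\<close>.\<close>

lemma has_bochner_integral_Gamma_exp: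
  fixes y :: real
  shows "has_bochner_integral lborel (\<lambda>s. cis (y * s) * exp (s - exp s)) (Gamma (1 + \<i> * y))"
proof -
  define z where "z = 1 + \<i> * complex_of_real y"
  let ?f = "\<lambda>t. complex_of_real t powr (z - 1) / of_real (exp t)"
  have z: "Re z > 0" by (simp add: z_def)
  have eq: "exp s *\<^sub>R ?f (exp s) = cis (y * s) * exp (s - exp s)" for s
    by (simp add: z_def powr_def cis_conv_exp scaleR_conv_of_real exp_diff mult_ac flip: exp_of_real)
  have int: "integrable lborel (\<lambda>s. cis (y * s) * exp (s - exp s))"
  proof (rule Bochner_Integration.integrable_bound)
    show "integrable lborel (\<lambda>s::real. exp (s - exp s))"
      using has_bochner_integral_exp_minus_exp by (simp add: has_bochner_integral_iff)
    show "AE s in lborel. cmod (cis (y * s) * exp (s - exp s)) \<le> norm (exp (s - exp s))"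
      by (simp add: norm_mult)
  qed (auto intro!: borel_measurable_continuous_onI continuous_intros)
  \<comment> \<open>Integrability is first obtained for Lebesgue measure; Borel measurability then
    transfers it to \<open>lborel\<close>.\<close>
  have "integrable lebesgue (\<lambda>x. indicator {0<..} x *\<^sub>R ?f x)"
    using absolutely_integrable_Gamma_integral'[OF z] by (simp add: set_integrable_def)
  moreover have "(\<lambda>x. indicator {0<..} x *\<^sub>R ?f x) \<in> borel_measurable lborel"
    by (auto intro!: borel_measurable_continuous_on_indicator continuous_intros)
  ultimately have int2: "set_integrable lborel {0<..} ?f"
    unfolding set_integrable_def by (simp add: integrable_completion)
  have e: "einterval 0 \<infinity> = {0<..}" by (auto simp: einterval_def)
  have "Gamma z = (LINT x:{0<..}|lborel. ?f x)"
    using set_borel_integral_eq_integral(2)[OF int2] Gamma_integral_complex'[OF z]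
    by (simp add: has_integral_iff)
  also have "\<dots> = (LBINT x=0..\<infinity>. ?f x)"
    by (simp add: interval_lebesgue_integral_def e)
  also have "\<dots> = (LBINT s=-\<infinity>..\<infinity>. exp s *\<^sub>R ?f (exp s))"
  proof (rule interval_integral_substitution_integrable)
    show "set_integrable lborel (einterval (- \<infinity>) \<infinity>) (\<lambda>s. exp s *\<^sub>R ?f (exp s))"
      unfolding eq using int by (simp add: set_integrable_def)
    show "set_integrable lborel (einterval 0 \<infinity>) ?f" using int2 by (simp add: e)
    show "((ereal \<circ> exp \<circ> real_of_ereal) \<longlongrightarrow> 0) (at_right (- \<infinity>))"
      unfolding comp_assoc ereal_tendsto_simps zero_ereal_def by (auto intro: exp_at_bot)
    show "((ereal \<circ> exp \<circ> real_of_ereal) \<longlongrightarrow> \<infinity>) (at_left \<infinity>)"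
      by (simp add: at_left_PInf filterlim_filtermap comp_def tendsto_PInfty_eq_at_top exp_at_top)
    show "isCont ?f (exp s)" for s
      by (auto intro!: continuous_intros)
  qed (auto intro!: derivative_eq_intros continuous_intros)
  also have "\<dots> = (\<integral>s. cis (y * s) * exp (s - exp s) \<partial>lborel)"
    unfolding eq by (simp add: interval_lebesgue_integral_def set_lebesgue_integral_def)
  finally show ?thesis
    using int by (simp add: has_bochner_integral_iff z_def)
qed

text \<open>The Gamma product is a double integral of \<open>g (-y) r * g y u\<close>. After the
  shift \<open>u = r + s\<close>, integrating over \<open>r\<close> first leaves the logistic
  density in \<open>s\<close>, while integrating over \<open>s\<close> first separates the two
  factors.\<close>

lemma integral_cis_logistic_deriv:
  fixes y :: real
  shows "(\<integral>s. cis (y * s) * (exp s / (1 + exp s)\<^sup>2) \<partial>lborel) = Gamma (1 + \<i> * y) * Gamma (1 - \<i> * y)"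
proof -
  define g where "g y s = cis (y * s) * exp (s - exp s)" for y s :: real
  define h where "h s r = cis (y * s) * exp s * exp (2 * r - (1 + exp s) * exp r)" for s r :: real
  have pos: "1 + exp s > 0" for s :: real by (smt (verit) exp_gt_zero)
  \<comment> \<open>The form \<open>r + 1 * s\<close> matches the affine substitution rule applied
    further down.\<close>
  have hg: "h s r = g (-y) r * g y (r + 1 * s)" for s r
  proof -
    have "cis (y * s) = cis (- y * r) * cis (y * (r + 1 * s))"
      by (simp add: cis_mult algebra_simps)
    moreover have "exp s * exp (2 * r - (1 + exp s) * exp r) =
        exp (r - exp r) * exp (r + 1 * s - exp (r + 1 * s))"
      by (simp add: algebra_simps exp_add flip: exp_add)
    ultimately show ?thesis
      unfolding h_def g_def by (metis (no_types, lifting) mult.assoc mult.left_commute of_real_mult)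
  qed
  have inner: "has_bochner_integral lborel (\<lambda>r. norm (h s r)) (exp s / (1 + exp s)\<^sup>2)" for s
    using has_bochner_integral_mult_right[OF has_bochner_integral_exp_double_minus_exp[OF pos], of "exp s" s]
    by (simp add: h_def norm_mult)
  have hm [measurable]: "case_prod h \<in> borel_measurable (lborel \<Otimes>\<^sub>M lborel)"
    unfolding lborel_prod h_def case_prod_unfold
    by (auto intro!: borel_measurable_continuous_onI continuous_intros)
  \<comment> \<open>Taking norms removes the phase: the \<open>r\<close>-integral is then the
    logistic density itself, which has total mass 1.\<close>
  have hint: "integrable (lborel \<Otimes>\<^sub>M lborel) (case_prod h)"
  proof (rule lborel_pair.Fubini_integrable[OF hm])
    show "integrable lborel (\<lambda>s. \<integral>r. norm (case_prod h (s, r)) \<partial>lborel)"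
      using has_bochner_integral_logistic_deriv
      by (simp add: has_bochner_integral_integral_eq[OF inner] has_bochner_integral_iff)
    show "AE s in lborel. integrable lborel (\<lambda>r. case_prod h (s, r))"
    proof (rule AE_I2)
      fix s :: real
      have "(\<lambda>r. h s r) \<in> borel_measurable lborel"
        unfolding h_def by (auto intro!: borel_measurable_continuous_onI continuous_intros)
      then show "integrable lborel (\<lambda>r. case_prod h (s, r))"
        using inner[of s] integrable_norm_cancel[of lborel "h s"] by (simp add: has_bochner_integral_iff)
    qed
  qed
  have "(\<integral>s. cis (y * s) * (exp s / (1 + exp s)\<^sup>2) \<partial>lborel) = (\<integral>s. (\<integral>r. h s r \<partial>lborel) \<partial>lborel)"
  proof (rule Bochner_Integration.integral_cong[OF refl])
    fix s :: real
    have "(\<integral>r. h s r \<partial>lborel) = cis (y * s) * exp s * of_real (\<integral>r. exp (2 * r - (1 + exp s) * exp r) \<partial>lborel)"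
      by (simp add: h_def)
    also have "\<dots> = cis (y * s) * (exp s / (1 + exp s)\<^sup>2)"
      by (simp add: has_bochner_integral_integral_eq[OF has_bochner_integral_exp_double_minus_exp[OF pos]])
    finally show "cis (y * s) * (exp s / (1 + exp s)\<^sup>2) = (\<integral>r. h s r \<partial>lborel)" by simp
  qed
  also have "\<dots> = (\<integral>r. (\<integral>s. h s r \<partial>lborel) \<partial>lborel)"
    by (rule lborel_pair.Fubini_integral[OF hint, symmetric])
  also have "\<dots> = (\<integral>r. g (-y) r * (\<integral>s. g y s \<partial>lborel) \<partial>lborel)"
  proof -
    have "(\<integral>s. g y s \<partial>lborel) = (\<integral>s. g y (r + 1 * s) \<partial>lborel)" for r
      by (subst lborel_integral_real_affine[of 1 _ r]) auto
    then show ?thesis unfolding hg by simp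
  qed
  also have "\<dots> = (\<integral>r. g (-y) r \<partial>lborel) * (\<integral>s. g y s \<partial>lborel)"
    by simp
  also have "\<dots> = Gamma (1 + \<i> * y) * Gamma (1 - \<i> * y)"
    using has_bochner_integral_integral_eq[OF has_bochner_integral_Gamma_exp[of y]]
      has_bochner_integral_integral_eq[OF has_bochner_integral_Gamma_exp[of "-y"]]
    by (simp add: g_def mult.commute)
  finally show ?thesis .
qed

text \<open>Combines \<open>Gamma (1 + z) = z * Gamma z\<close> with the reflection formula at
  \<open>z = \<i> * y\<close>, where the sine becomes \<open>\<i> * sinh (pi * y)\<close>. For
  \<open>y \<noteq> 0\<close> the point \<open>z\<close> is not a pole.\<close>

lemma integral_cis_logistic_deriv_eq_sinh:
  fixes y :: real
  assumes "y \<noteq> 0"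
  shows "(\<integral>s. cis (y * s) * (exp s / (1 + exp s)\<^sup>2) \<partial>lborel) = of_real (pi * y / sinh (pi * y))"
proof -
  have s: "sin (complex_of_real pi * (\<i> * of_real y)) = \<i> * of_real (sinh (pi * y))"
    by (simp add: sin_i_times mult.left_commute[of _ \<i>] sinh_field_def flip: of_real_mult exp_of_real)
       (simp add: exp_minus)
  have nonint: "\<i> * complex_of_real y \<notin> \<int>\<^sub>\<le>\<^sub>0"
    using assms by (auto simp: nonpos_Ints_def complex_eq_iff)
  have "Gamma (1 + \<i> * y) * Gamma (1 - \<i> * y) = \<i> * y * (Gamma (\<i> * y) * Gamma (1 - \<i> * y))"
    using Gamma_plus1[of "\<i> * complex_of_real y"] nonint by (simp add: add.commute)
  also have "\<dots> = of_real (pi * y / sinh (pi * y))"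
    using assms by (simp add: Gamma_reflection_complex s)
  finally show ?thesis by (simp only: integral_cis_logistic_deriv)
qed

section \<open>Fourier integral of sinh t / (cosh t + cosh s)\<close>

lemma integral_even_eq_double:
  fixes f :: "real \<Rightarrow> 'a :: {banach, second_countable_topology}"
  assumes "integrable lborel f" "\<And>x. f (- x) = f x"
  shows "(\<integral>x. f x \<partial>lborel) = 2 *\<^sub>R (\<integral>x. indicator {0<..} x *\<^sub>R f x \<partial>lborel)"
proof -
  have [measurable]: "f \<in> borel_measurable borel"
    using assms(1) borel_measurable_integrable by force
  have i: "integrable lborel (\<lambda>x. indicator {0<..} x *\<^sub>R f x)"
          "integrable lborel (\<lambda>x. indicator {..<0} x *\<^sub>R f x)"
    using assms(1) by (auto intro!: integrable_mult_indicator)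
  have "(\<integral>x. f x \<partial>lborel) = (\<integral>x. indicator {0<..} x *\<^sub>R f x + indicator {..<0} x *\<^sub>R f x \<partial>lborel)"
  proof (rule integral_cong_AE)
    show "AE x in lborel. f x = indicator {0<..} x *\<^sub>R f x + indicator {..<0} x *\<^sub>R f x"
      using AE_lborel_singleton[of 0] by eventually_elim (auto split: split_indicator)
  qed (use assms in auto)
  also have "\<dots> = (\<integral>x. indicator {0<..} x *\<^sub>R f x \<partial>lborel) + (\<integral>x. indicator {..<0} x *\<^sub>R f x \<partial>lborel)"
    using i by simp
  also have "(\<integral>x. indicator {..<0} x *\<^sub>R f x \<partial>lborel) = (\<integral>x. indicator {0<..} x *\<^sub>R f x \<partial>lborel)"
    by (subst lborel_integral_real_affine[of "-1" _ 0]) (simp_all add: assms indicator_def)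
  finally show ?thesis by (simp add: scaleR_2)
qed

text \<open>This is the convolution of the logistic density with the indicator of
  \<open>{-t..t}\<close>. In \<open>r\<close> the antiderivative is
  \<open>1 / (1 + exp (s - r))\<close>, and its increment simplifies to the hyperbolic
  quotient.\<close>

lemma has_bochner_integral_logistic_shift:
  fixes s t :: real
  assumes "0 \<le> t"
  shows "has_bochner_integral lborel
           (\<lambda>r. indicator {-t..t} r * (exp (s - r) / (1 + exp (s - r))\<^sup>2)) (sinh t / (cosh t + cosh s))"
proof -
  have nz: "1 + exp u \<noteq> 0" for u :: real
    by (smt (verit) exp_gt_zero)
  have cpos: "cosh t + cosh s > 0"
    by (simp add: add_pos_pos)
  have eq: "1 / (1 + exp (s - t)) - 1 / (1 + exp (s - (-t))) = sinh t / (cosh t + cosh s)"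
  proof -
    have "sinh t * ((1 + exp (s - t)) * (1 + exp (s + t))) =
        (exp (s + t) - exp (s - t)) * (cosh t + cosh s)"
      by (simp add: sinh_field_def cosh_field_def exp_diff exp_add exp_minus field_simps)
    then show ?thesis
      using nz[of "s - t"] nz[of "s + t"] cpos by (simp add: diff_divide_eq_iff divide_diff_eq_iff frac_eq_eq)
  qed
  have "has_bochner_integral lborel
      (\<lambda>r. (exp (s - r) / (1 + exp (s - r))\<^sup>2) * indicator {-t..t} r)
      (1 / (1 + exp (s - t)) - 1 / (1 + exp (s - (-t))))"
  proof (rule has_bochner_integral_FTC_Icc_real)
    show "((\<lambda>r. 1 / (1 + exp (s - r))) has_real_derivative exp (s - r) / (1 + exp (s - r))\<^sup>2) (at r)" for r
      using nz[of "s - r"] by (auto intro!: derivative_eq_intros simp: field_simps power2_eq_square)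
  qed (use assms nz in \<open>auto intro!: continuous_intros\<close>)
  then show ?thesis unfolding eq by (simp add: mult.commute)
qed

text \<open>Fubini for the convolution: the \<open>s\<close>-integral contributes
  \<open>pi * y / sinh (pi * y)\<close> times \<open>cis (y * r)\<close>, and integrating this phase
  over \<open>{-t..t}\<close> gives \<open>2 * sin (y * t) / y\<close>, so the factor
  \<open>y\<close> cancels.\<close>

lemma
  fixes t y :: real
  assumes t: "0 \<le> t" and y: "y \<noteq> 0"
  shows integrable_cis_sinh_over_cosh:
      "integrable lborel (\<lambda>s. cis (y * s) * (sinh t / (cosh t + cosh s)))"
    and integral_cis_sinh_over_cosh:
      "(\<integral>s. cis (y * s) * (sinh t / (cosh t + cosh s)) \<partial>lborel) = of_real (2 * pi * sin (y * t) / sinh (pi * y))"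
proof -
  define k where "k s = exp s / (1 + exp s)\<^sup>2" for s :: real
  have nz: "1 + exp u \<noteq> 0" for u :: real
    by (smt (verit) exp_gt_zero)
  have k0: "k s \<ge> 0" for s by (simp add: k_def)
  have kc: "continuous_on A k" for A unfolding k_def using nz by (auto intro!: continuous_intros)
  have km [measurable]: "k \<in> borel_measurable borel"
    using kc by (rule borel_measurable_continuous_onI)
  have ki: "integrable lborel k" "(\<integral>s. k s \<partial>lborel) = 1"
    using has_bochner_integral_logistic_deriv by (auto simp: has_bochner_integral_iff k_def[abs_def])
  have kshift: "integrable lborel (\<lambda>s. k (s - r))" "(\<integral>s. k (s - r) \<partial>lborel) = 1" for r
    using lborel_integrable_real_affine[OF ki(1), of 1 "-r"]
      lborel_integral_real_affine[of 1 k "-r"] ki by auto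
  have [measurable]: "cis \<in> borel_measurable borel"
    by (auto intro!: borel_measurable_continuous_onI continuous_intros)
  define f where "f r s = complex_of_real (indicator {-t..t} r) * (cis (y * s) * of_real (k (s - r)))" for r s
  have fm [measurable]: "case_prod f \<in> borel_measurable (lborel \<Otimes>\<^sub>M lborel)"
    unfolding f_def case_prod_unfold by measurable
  have fi: "integrable (lborel \<Otimes>\<^sub>M lborel) (case_prod f)"
  proof (rule lborel_pair.Fubini_integrable[OF fm])
    \<comment> \<open>Each translate of \<open>k\<close> has mass 1, so the
      \<open>s\<close>-integral of the norm is just the indicator of a bounded interval.\<close>
    have "norm (f r s) = indicator {-t..t} r * k (s - r)" for r s
      using k0[of "s - r"] by (simp add: f_def norm_mult)
    then have "(\<lambda>r. \<integral>s. norm (case_prod f (r, s)) \<partial>lborel) = indicator {-t..t}"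
      by (simp add: kshift fun_eq_iff)
    then show "integrable lborel (\<lambda>r. \<integral>s. norm (case_prod f (r, s)) \<partial>lborel)"
      using t by simp
    show "AE r in lborel. integrable lborel (\<lambda>s. case_prod f (r, s))"
    proof (rule AE_I2)
      fix r :: real
      have "integrable lborel (\<lambda>s. cis (y * s) * of_real (k (s - r)))"
        by (rule Bochner_Integration.integrable_bound[OF kshift(1)[of r]]) (auto simp: norm_mult)
      then show "integrable lborel (\<lambda>s. case_prod f (r, s))"
        by (simp add: f_def)
    qed
  qed
  have int_r: "(\<integral>r. f r s \<partial>lborel) = cis (y * s) * (sinh t / (cosh t + cosh s))" for s
  proof -
    have "(\<integral>r. f r s \<partial>lborel) = (\<integral>r. cis (y * s) * of_real (indicator {-t..t} r * k (s - r)) \<partial>lborel)"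
      by (simp add: f_def mult_ac)
    also have "\<dots> = cis (y * s) * of_real (\<integral>r. indicator {-t..t} r * k (s - r) \<partial>lborel)"
      by (subst integral_mult_right_zero) (simp only: integral_complex_of_real)
    finally show ?thesis
      using has_bochner_integral_logistic_shift[OF t, of s]
      by (simp add: k_def has_bochner_integral_iff)
  qed
  have int_s: "(\<integral>s. f r s \<partial>lborel) =
      of_real (pi * y / sinh (pi * y)) * (indicator {-t..t} r *\<^sub>R cis (y * r))" for r
  proof -
    \<comment> \<open>Translating by \<open>r\<close> centres \<open>k\<close> and pulls out the
      phase \<open>cis (y * r)\<close>.\<close>
    have "(\<integral>s. cis (y * s) * of_real (k (s - r)) \<partial>lborel) =
        (\<integral>s. cis (y * (r + 1 * s)) * of_real (k ((r + 1 * s) - r)) \<partial>lborel)"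
      by (subst lborel_integral_real_affine[of 1 _ r]) simp_all
    also have "\<dots> = (\<integral>s. cis (y * r) * (cis (y * s) * of_real (k s)) \<partial>lborel)"
      by (intro Bochner_Integration.integral_cong) (simp_all add: cis_mult distrib_left flip: mult.assoc)
    also have "\<dots> = cis (y * r) * of_real (pi * y / sinh (pi * y))"
      by (subst integral_mult_right_zero) (simp only: k_def integral_cis_logistic_deriv_eq_sinh[OF y])
    finally show ?thesis
      unfolding f_def integral_mult_right_zero by (simp add: scaleR_conv_of_real mult_ac)
  qed
  show "integrable lborel (\<lambda>s. cis (y * s) * (sinh t / (cosh t + cosh s)))"
    using lborel_pair.integrable_snd[OF fi] by (simp add: int_r)
  have *: "has_bochner_integral lborel (\<lambda>r. indicator {-t..t} r *\<^sub>R cis (y * r))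
     (cis (y * t) / (\<i> * y) - cis (y * (-t)) / (\<i> * y))"
  proof (rule has_bochner_integral_FTC_Icc)
    show "((\<lambda>r. cis (y * r) / (\<i> * y)) has_vector_derivative cis (y * r)) (at r within {-t..t})" for r
      using y unfolding cis_conv_exp
      by (auto intro!: derivative_eq_intros has_vector_derivative_real_field simp: field_simps)
  qed (use t in \<open>auto intro!: continuous_intros\<close>)
  have cint: "(\<integral>r. indicator {-t..t} r *\<^sub>R cis (y * r) \<partial>lborel) = of_real (2 * sin (y * t) / y)"
  proof -
    have "cis (y * t) - cis (y * (-t)) = \<i> * of_real (2 * sin (y * t))"
      by (simp add: complex_eq_iff)
    with * y show ?thesis
      by (simp add: has_bochner_integral_iff flip: diff_divide_distrib)
  qed
  have "(\<integral>s. cis (y * s) * (sinh t / (cosh t + cosh s)) \<partial>lborel) = (\<integral>s. (\<integral>r. f r s \<partial>lborel) \<partial>lborel)"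
    by (simp add: int_r)
  also have "\<dots> = (\<integral>r. (\<integral>s. f r s \<partial>lborel) \<partial>lborel)"
    by (rule lborel_pair.Fubini_integral[OF fi])
  also have "\<dots> = of_real (pi * y / sinh (pi * y)) * of_real (2 * sin (y * t) / y)"
    unfolding int_s by (subst integral_mult_right_zero) (simp only: cint)
  finally show "(\<integral>s. cis (y * s) * (sinh t / (cosh t + cosh s)) \<partial>lborel) =
      of_real (2 * pi * sin (y * t) / sinh (pi * y))"
    using y by (simp add: field_simps)
qed

text \<open>Take the real part of the previous integral; its integrand is even in \<open>s\<close>,
  so the half-line carries half of the value.\<close>

lemma has_bochner_integral_cos_sinh_over_cosh:
  fixes t y :: real
  assumes "0 \<le> t" "y \<noteq> 0"
  shows "has_bochner_integral lborel
    (\<lambda>s. indicator {0<..} s * (cos (y * s) * (sinh t / (cosh t + cosh s)))) (pi * sin (y * t) / sinh (pi * y))"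
proof -
  note I = integrable_cis_sinh_over_cosh[OF assms]
  have re: "Re (cis (y * s) * (sinh t / (cosh t + cosh s))) = cos (y * s) * (sinh t / (cosh t + cosh s))" for s
    by (simp flip: of_real_divide of_real_add)
  have i: "integrable lborel (\<lambda>s. cos (y * s) * (sinh t / (cosh t + cosh s)))"
    using integrable_Re[OF I] by (simp only: re)
  have "(\<integral>s. cos (y * s) * (sinh t / (cosh t + cosh s)) \<partial>lborel) = 2 * pi * sin (y * t) / sinh (pi * y)"
    using integral_Re[OF I] by (simp only: re integral_cis_sinh_over_cosh[OF assms] Re_complex_of_real)
  moreover have "integrable lborel (\<lambda>s. indicator {0<..} s *\<^sub>R (cos (y * s) * (sinh t / (cosh t + cosh s))))"
    using i by (intro integrable_mult_indicator) auto
  ultimately show ?thesis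
    using integral_even_eq_double[OF i] by (simp add: has_bochner_integral_iff)
qed

section \<open>Beta integrals on a half-line\<close>

text \<open>Up to a constant the antiderivative is \<open>((x - c) / (x + b)) powr \<beta>\<close>,
  which rises from 0 at \<open>c\<close> to 1 at infinity.\<close>

lemma has_bochner_integral_beta_halfline:
  fixes b c \<beta> :: real
  assumes "b + c > 0" "\<beta> > 0"
  shows "has_bochner_integral lborel
    (\<lambda>x. indicator {c<..} x * ((x + b) powr (- \<beta> - 1) * (x - c) powr (\<beta> - 1))) (1 / (\<beta> * (b + c)))"
proof -
  define F where "F x = ((x - c) / (x + b)) powr \<beta> / (\<beta> * (b + c))" for x
  define f where "f x = (x + b) powr (- \<beta> - 1) * (x - c) powr (\<beta> - 1)" for x
  have F: "(F has_real_derivative f x) (at x)" if "x > c" for x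
  proof -
    have pos: "x - c > 0" "x + b > 0" using that assms by auto
    have f: "f x = ((x - c) / (x + b)) powr (\<beta> - 1) / (x + b)\<^sup>2"
    proof -
      have "(x + b) powr (- \<beta> - 1) * ((x + b) powr (\<beta> - 1) * (x + b) powr 2) = 1"
        using pos by (simp del: powr_numeral flip: powr_add)
      then show ?thesis
        using pos by (simp add: f_def powr_divide divide_simps mult_ac)
    qed
    have "(F has_real_derivative
        \<beta> * ((x - c) / (x + b)) powr (\<beta> - 1) * ((b + c) / (x + b)\<^sup>2) / (\<beta> * (b + c))) (at x)"
      unfolding F_def using pos
      by (auto intro!: derivative_eq_intros simp: power2_eq_square)
    then show ?thesis
      unfolding f using assms by simp
  qed
  have c: "isCont f x" if "x > c" for x
    unfolding f_def using that assms by (auto intro!: continuous_intros)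
  have e: "einterval (ereal c) \<infinity> = {c<..}" by (auto simp: einterval_def)
  have "((\<lambda>x. (x - c) / (x + b)) \<longlongrightarrow> 0) (at_right c)"
  proof -
    have "((\<lambda>x. (x - c) / (x + b)) \<longlongrightarrow> (c - c) / (c + b)) (at_right c)"
      using assms by (intro tendsto_intros) auto
    then show ?thesis by simp
  qed
  moreover have "eventually (\<lambda>x. x \<in> {c<..}) (at_right c)"
    by (auto simp: eventually_at_filter)
  then have "eventually (\<lambda>x. (x - c) / (x + b) \<ge> 0) (at_right c)"
    by eventually_elim (use assms in auto)
  ultimately have "((\<lambda>x. ((x - c) / (x + b)) powr \<beta>) \<longlongrightarrow> 0 powr \<beta>) (at_right c)"
    using assms by (intro tendsto_powr') auto
  then have "(F \<longlongrightarrow> 0 / (\<beta> * (b + c))) (at_right c)"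
    unfolding F_def by (intro tendsto_intros) (use assms in auto)
  then have A: "((F \<circ> real_of_ereal) \<longlongrightarrow> 0) (at_right (ereal c))"
    by (simp add: ereal_tendsto_simps)
  have "((\<lambda>x. (x - c) / (x + b)) \<longlongrightarrow> 1) at_top" by real_asymp
  then have "((\<lambda>x. ((x - c) / (x + b)) powr \<beta>) \<longlongrightarrow> 1 powr \<beta>) at_top"
    by (intro tendsto_intros) auto
  then have "(F \<longlongrightarrow> 1 / (\<beta> * (b + c))) at_top"
    unfolding F_def by (intro tendsto_intros) (use assms in auto)
  then have B: "((F \<circ> real_of_ereal) \<longlongrightarrow> 1 / (\<beta> * (b + c))) (at_left \<infinity>)"
    by (simp add: ereal_tendsto_simps)
  have f0: "f x \<ge> 0" for x by (simp add: f_def)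
  have "set_integrable lborel (einterval (ereal c) \<infinity>) f"
       "(LBINT x=ereal c..\<infinity>. f x) = 1 / (\<beta> * (b + c)) - 0"
    by (rule interval_integral_FTC_nonneg[where F = F]; use F c f0 A B in simp)+
  then show ?thesis
    by (simp add: has_bochner_integral_iff interval_lebesgue_integral_def e
        set_integrable_def set_lebesgue_integral_def f_def)
qed

text \<open>Same antiderivative as in the real case. The real integral with exponent
  \<open>Re \<beta>\<close> supplies integrability, since it is the integral of the norm.\<close>

lemma has_bochner_integral_beta_halfline_complex:
  fixes b c :: real and \<beta> :: complex
  assumes "b + c > 0" "Re \<beta> > 0"
  shows "has_bochner_integral lborel
    (\<lambda>x. indicator {c<..} x *\<^sub>R (of_real (x + b) powr (- \<beta> - 1) * of_real (x - c) powr (\<beta> - 1)))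
    (1 / (\<beta> * of_real (b + c)))"
proof -
  have \<beta>0: "\<beta> \<noteq> 0" using assms by auto
  define K where "K = \<beta> * of_real (b + c)"
  \<comment> \<open>A difference of logarithms makes the power complex differentiable at real points
    above \<open>c\<close>; its restriction to the real line is then the antiderivative.\<close>
  define G where "G z = exp (\<beta> * (Ln (z - of_real c) - Ln (z + of_real b))) / K" for z
  define F where "F x = G (of_real x)" for x :: real
  define f where "f x = complex_of_real (x + b) powr (- \<beta> - 1) * of_real (x - c) powr (\<beta> - 1)" for x
  have F: "(F has_vector_derivative f x) (at x)" if "x > c" for x
    unfolding F_def
  proof (rule has_vector_derivative_real_field)
    have pos: "x - c > 0" "x + b > 0" using that assms by auto
    have nn: "complex_of_real x - of_real c \<notin> \<real>\<^sub>\<le>\<^sub>0" "complex_of_real x + of_real b \<notin> \<real>\<^sub>\<le>\<^sub>0"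
      using pos by (simp_all flip: of_real_diff of_real_add)
    have nz: "complex_of_real x - of_real c \<noteq> 0" "complex_of_real x + of_real b \<noteq> 0"
      using pos by (simp_all flip: of_real_diff of_real_add)
    have f: "f x = exp (\<beta> * (Ln (of_real x - of_real c) - Ln (of_real x + of_real b))) /
        ((of_real x - of_real c) * (of_real x + of_real b))"
      using nz by (simp add: f_def powr_diff powr_minus) (simp add: powr_def exp_diff right_diff_distrib field_simps)
    have "1 / (of_real x - of_real c) - 1 / (of_real x + of_real b) =
        of_real (b + c) / ((of_real x - of_real c) * (complex_of_real x + of_real b))"
      using nz by (simp add: field_simps)
    then have f': "f x = exp (\<beta> * (Ln (of_real x - of_real c) - Ln (of_real x + of_real b))) *
        (\<beta> * (1 / (of_real x - of_real c) - 1 / (of_real x + of_real b))) / K"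
      unfolding f K_def using assms \<beta>0 by (simp del: of_real_add)
    show "(G has_field_derivative f x) (at (of_real x))"
      unfolding G_def f' using nn by (auto intro!: derivative_eq_intros simp: divide_inverse)
  qed
  have c: "isCont f x" if "x > c" for x
    unfolding f_def using that assms
    by (auto intro!: continuous_intros simp flip: of_real_diff of_real_add)
  have e: "einterval (ereal c) \<infinity> = {c<..}" by (auto simp: einterval_def)
  \<comment> \<open>For \<open>x > c\<close> both logarithms are real, so \<open>F\<close> is a
    principal power of a positive quotient.\<close>
  have Feq: "F x = of_real ((x - c) / (x + b)) powr \<beta> / K" if "x > c" for x
    using that assms by (simp add: F_def G_def powr_def Ln_of_real ln_div flip: of_real_diff of_real_add of_real_divide)
  have lim: "((\<lambda>x. (x - c) / (x + b)) \<longlongrightarrow> 0) (at_right c)"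
  proof -
    have "((\<lambda>x. (x - c) / (x + b)) \<longlongrightarrow> (c - c) / (c + b)) (at_right c)"
      using assms by (intro tendsto_intros) auto
    then show ?thesis by simp
  qed
  have ev: "eventually (\<lambda>x. x \<in> {c<..}) (at_right c)"
    by (auto simp: eventually_at_filter)
  then have "eventually (\<lambda>x. (x - c) / (x + b) \<ge> 0) (at_right c)"
    by eventually_elim (use assms in auto)
  \<comment> \<open>For non-real \<open>\<beta>\<close> the phase oscillates as \<open>x\<close>
    tends to \<open>c\<close>; the limit 0 is therefore obtained through the norm.\<close>
  with lim have "((\<lambda>x. ((x - c) / (x + b)) powr Re \<beta> / norm K) \<longlongrightarrow> 0 powr Re \<beta> / norm K) (at_right c)"
    using assms \<beta>0 by (intro tendsto_powr' tendsto_divide tendsto_const) (auto simp: K_def simp flip: of_real_add)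
  then have "((\<lambda>x. ((x - c) / (x + b)) powr Re \<beta> / norm K) \<longlongrightarrow> 0) (at_right c)" by simp
  moreover have "eventually (\<lambda>x. norm (F x) = ((x - c) / (x + b)) powr Re \<beta> / norm K) (at_right c)"
    using ev
  proof eventually_elim
    case (elim x)
    then have "(x - c) / (x + b) > 0" using assms by auto
    then show ?case using elim by (simp add: Feq norm_divide norm_powr_real_powr del: of_real_divide)
  qed
  ultimately have "((\<lambda>x. norm (F x)) \<longlongrightarrow> 0) (at_right c)"
    by (simp add: tendsto_cong)
  then have A: "((F \<circ> real_of_ereal) \<longlongrightarrow> 0) (at_right (ereal c))"
    by (simp add: ereal_tendsto_simps tendsto_norm_zero_iff)
  have "((\<lambda>x. (x - c) / (x + b)) \<longlongrightarrow> 1) at_top" by real_asymp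
  then have "((\<lambda>x. complex_of_real ((x - c) / (x + b)) powr \<beta> / K) \<longlongrightarrow> of_real 1 powr \<beta> / K) at_top"
    using assms \<beta>0 by (intro tendsto_powr_complex tendsto_divide tendsto_of_real tendsto_const)
      (auto simp: K_def simp flip: of_real_add)
  moreover have "eventually (\<lambda>x. F x = of_real ((x - c) / (x + b)) powr \<beta> / K) at_top"
    using eventually_gt_at_top[of c] by eventually_elim (rule Feq)
  ultimately have "(F \<longlongrightarrow> 1 / K) at_top"
    by (simp add: tendsto_cong)
  then have B: "((F \<circ> real_of_ereal) \<longlongrightarrow> 1 / K) (at_left \<infinity>)"
    by (simp add: ereal_tendsto_simps)
  have int: "set_integrable lborel {c<..} f"
    unfolding set_integrable_def
  proof (rule Bochner_Integration.integrable_bound)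
    show "integrable lborel (\<lambda>x. indicator {c<..} x * ((x + b) powr (- Re \<beta> - 1) * (x - c) powr (Re \<beta> - 1)))"
      using has_bochner_integral_beta_halfline[OF assms] by (simp add: has_bochner_integral_iff)
    show "(\<lambda>x. indicator {c<..} x *\<^sub>R f x) \<in> borel_measurable lborel"
      using c by (auto intro!: borel_measurable_continuous_on_indicator simp: continuous_on_eq_continuous_at)
    show "AE x in lborel. norm (indicator {c<..} x *\<^sub>R f x) \<le>
        norm (indicator {c<..} x * ((x + b) powr (- Re \<beta> - 1) * (x - c) powr (Re \<beta> - 1)))"
      using assms by (auto simp: f_def norm_mult norm_powr_real_powr split: split_indicator
          simp flip: of_real_diff of_real_add)
  qed
  have "(LBINT x=ereal c..\<infinity>. f x) = 1 / K - 0"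
    by (rule interval_integral_FTC_integrable[where F = F]) (use F c A B int in \<open>simp_all add: e\<close>)
  with int show ?thesis
    by (simp add: has_bochner_integral_iff interval_lebesgue_integral_def e
        set_integrable_def set_lebesgue_integral_def f_def K_def)
qed

section \<open>The Abel-type integral in the Legendre function\<close>

text \<open>Extending by zero encodes the domain \<open>0 < s < arcosh x\<close> in the function
  itself, so that all integrals run over \<open>lborel\<close> and Fubini applies without moving
  limits.\<close>

definition abel_kernel :: "complex \<Rightarrow> real \<Rightarrow> real \<Rightarrow> complex" where
  "abel_kernel \<mu> x s = (if 0 < s \<and> cosh s < x then of_real (x - cosh s) powr (- 1/2 - \<mu>) else 0)"

text \<open>For \<open>x > 1\<close> this is the factor B(x) of the introduction, with a real
  frequency \<open>y\<close> in place of \<open>m\<close>.\<close>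

definition abel_transform :: "complex \<Rightarrow> real \<Rightarrow> real \<Rightarrow> complex" where
  "abel_transform \<mu> y x = (\<integral>s. of_real (cos (y * s)) * abel_kernel \<mu> x s \<partial>lborel)"

text \<open>A bound for \<open>abel_transform\<close> that is uniform in the frequency
  \<open>y\<close>, which is what allows summation over \<open>m\<close>.\<close>

definition abel_majorant :: "complex \<Rightarrow> real \<Rightarrow> real" where
  "abel_majorant \<mu> x = (\<integral>s. norm (abel_kernel \<mu> x s) \<partial>lborel)"

lemma measurable_cosh_real [measurable]: "(cosh :: real \<Rightarrow> real) \<in> borel_measurable borel"
  by (auto intro!: borel_measurable_continuous_onI continuous_intros)

lemma measurable_sinh_real [measurable]: "(sinh :: real \<Rightarrow> real) \<in> borel_measurable borel"
  by (auto intro!: borel_measurable_continuous_onI continuous_intros)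

lemma measurable_abel_kernel [measurable (raw)]:
  assumes [measurable]: "f \<in> borel_measurable M" "g \<in> borel_measurable M"
  shows "(\<lambda>z. abel_kernel \<mu> (f z) (g z)) \<in> borel_measurable M"
  unfolding abel_kernel_def by measurable

lemma norm_abel_kernel:
  "norm (abel_kernel \<mu> x s) =
     (if 0 < s \<and> cosh s < x then (x - cosh s) powr (- 1/2 - Re \<mu>) else 0)"
  by (simp add: abel_kernel_def norm_powr_real_powr flip: of_real_diff)

lemma abel_kernel_eq_0: "x \<le> 1 \<Longrightarrow> abel_kernel \<mu> x s = 0"
  using cosh_real_ge_1[of s] by (simp add: abel_kernel_def)

lemma measurable_abel_transform [measurable]: "abel_transform \<mu> y \<in> borel_measurable borel"
  unfolding abel_transform_def[abs_def] by measurable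

lemma measurable_abel_majorant [measurable]: "abel_majorant \<mu> \<in> borel_measurable borel"
  unfolding abel_majorant_def[abs_def] by measurable

lemma abel_majorant_nonneg: "abel_majorant \<mu> x \<ge> 0"
  by (simp add: abel_majorant_def)

lemma abel_transform_eq_0: "x \<le> 1 \<Longrightarrow> abel_transform \<mu> y x = 0"
  by (simp add: abel_transform_def abel_kernel_eq_0)

section \<open>Integrability of the Abel kernel at its singularity and with a weight at
  infinity\<close>

lemma sinh_real_ge_self:
  fixes x :: real
  assumes "0 \<le> x"
  shows "x \<le> sinh x"
proof -
  have "sinh 0 - 0 \<le> sinh x - x"
  proof (rule DERIV_nonneg_imp_nondecreasing[OF assms])
    fix u :: real
    show "\<exists>d. ((\<lambda>u. sinh u - u) has_real_derivative d) (at u) \<and> 0 \<le> d"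
      by (rule exI[of _ "cosh u - 1"]) (auto intro!: derivative_eq_intros simp: cosh_real_ge_1)
  qed
  then show ?thesis by simp
qed

text \<open>The difference factors as
  \<open>2 * sinh ((\<alpha> + s) / 2) * sinh ((\<alpha> - s) / 2)\<close>. The resulting linear
  lower bound controls the singularity of the kernel at \<open>s = \<alpha>\<close>.\<close>

lemma cosh_diff_ge:
  fixes s \<alpha> :: real
  assumes "0 \<le> s" "s \<le> \<alpha>"
  shows "sinh (\<alpha> / 2) * (\<alpha> - s) \<le> cosh \<alpha> - cosh s"
proof -
  have "cosh \<alpha> - cosh s = 2 * sinh ((\<alpha> + s) / 2) * sinh ((\<alpha> - s) / 2)"
  proof -
    define u v where "u = (\<alpha> + s) / 2" and "v = (\<alpha> - s) / 2"
    have "\<alpha> = u + v" "s = u - v" by (auto simp: u_def v_def field_simps)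
    then show ?thesis by (simp add: cosh_add cosh_diff)
  qed
  moreover have "sinh (\<alpha> / 2) * ((\<alpha> - s) / 2) \<le> sinh ((\<alpha> + s) / 2) * sinh ((\<alpha> - s) / 2)"
    using assms by (intro mult_mono sinh_real_ge_self) auto
  ultimately show ?thesis by simp
qed

text \<open>Near \<open>s = arcosh x\<close> the kernel grows at most like a power of the distance
  with exponent \<open>p = - 1/2 - Re \<mu>\<close>, and \<open>Re \<mu> < 1/2\<close> means
  \<open>p > -1\<close>.\<close>

lemma integrable_abel_kernel:
  assumes "Re \<mu> < 1/2" "x > 1"
  shows "integrable lborel (abel_kernel \<mu> x)"
proof -
  define \<alpha> where "\<alpha> = arcosh x"
  define p where "p = - 1/2 - Re \<mu>"
  define \<kappa> where "\<kappa> = sinh (\<alpha> / 2)"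
  have \<alpha>: "\<alpha> > 0" "cosh \<alpha> = x" using assms by (simp_all add: \<alpha>_def)
  have \<kappa>: "\<kappa> > 0" using \<alpha> by (simp add: \<kappa>_def)
  have p: "p > -1" using assms by (simp add: p_def)
  have "(\<lambda>u. u powr p) absolutely_integrable_on {0..\<alpha>}"
    using integrable_on_powr_from_0[OF p, of \<alpha>] \<alpha>
    by (subst absolutely_integrable_on_iff_nonneg) auto
  then have "integrable lborel (\<lambda>u. indicator {0..\<alpha>} u *\<^sub>R u powr p)"
    unfolding set_integrable_def by (subst (asm) integrable_completion) auto
  from lborel_integrable_real_affine[OF this, of "-1" \<alpha>]
  have "integrable lborel (\<lambda>s. indicator {0..\<alpha>} (\<alpha> - s) * (\<alpha> - s) powr p)" by simp
  \<comment> \<open>The first summand dominates the kernel when \<open>p \<ge> 0\<close>, the second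
    when \<open>p < 0\<close>; the sum covers both signs at once.\<close>
  then have i: "integrable lborel
      (\<lambda>s. indicator {0..\<alpha>} s * x powr p + \<kappa> powr p * (indicator {0..\<alpha>} (\<alpha> - s) * (\<alpha> - s) powr p))"
    using \<alpha> by (intro Bochner_Integration.integrable_add integrable_mult_right integrable_mult_left) auto
  show ?thesis
  proof (rule Bochner_Integration.integrable_bound[OF i])
    show "AE s in lborel. norm (abel_kernel \<mu> x s) \<le> norm (indicator {0..\<alpha>} s * x powr p +
        \<kappa> powr p * (indicator {0..\<alpha>} (\<alpha> - s) * (\<alpha> - s) powr p))"
    proof (rule AE_I2)
      fix s
      show "norm (abel_kernel \<mu> x s) \<le> norm (indicator {0..\<alpha>} s * x powr p +
        \<kappa> powr p * (indicator {0..\<alpha>} (\<alpha> - s) * (\<alpha> - s) powr p))"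
      proof (cases "0 < s \<and> cosh s < x")
        case True
        then have s: "0 < s" "s < \<alpha>" using cosh_real_nonneg_less_iff[of s \<alpha>] \<alpha> by auto
        have "(x - cosh s) powr p \<le> x powr p + \<kappa> powr p * (\<alpha> - s) powr p"
        proof (cases "p \<ge> 0")
          case True
          then have "(x - cosh s) powr p \<le> x powr p"
            using s \<alpha> \<open>0 < s \<and> cosh s < x\<close> by (intro powr_mono2) auto
          then show ?thesis by (smt (verit) mult_nonneg_nonneg powr_ge_zero)
        next
          case False
          then have "(x - cosh s) powr p \<le> (\<kappa> * (\<alpha> - s)) powr p"
            using cosh_diff_ge[of s \<alpha>] s \<alpha> \<kappa> by (intro powr_mono2') (auto simp: \<kappa>_def)
          also have "\<dots> = \<kappa> powr p * (\<alpha> - s) powr p"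
            using s \<kappa> by (simp add: powr_mult)
          finally show ?thesis by (smt (verit) powr_ge_zero)
        qed
        then show ?thesis using s True by (simp add: norm_abel_kernel p_def)
      next
        case False
        then show ?thesis by (simp only: norm_abel_kernel if_False norm_ge_zero)
      qed
    qed
  qed measurable
qed

lemma norm_abel_transform_le:
  assumes "Re \<mu> < 1/2" "x > 1"
  shows "norm (abel_transform \<mu> y x) \<le> abel_majorant \<mu> x"
proof -
  have n: "integrable lborel (\<lambda>s. norm (abel_kernel \<mu> x s))"
    using integrable_abel_kernel[OF assms] by simp
  have b: "norm (of_real (cos (y * s)) * abel_kernel \<mu> x s) \<le> norm (abel_kernel \<mu> x s)" for s
    by (simp add: norm_mult mult_left_le_one_le)
  have "integrable lborel (\<lambda>s. of_real (cos (y * s)) * abel_kernel \<mu> x s)"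
    by (rule Bochner_Integration.integrable_bound[OF n]) (use b in auto)
  then show ?thesis
    unfolding abel_transform_def abel_majorant_def
    by (intro order_trans[OF integral_norm_bound] integral_mono n b) simp
qed

text \<open>Integrating over \<open>x\<close> first is a beta integral with \<open>b = 1\<close> and
  \<open>c = cosh s\<close>. It gives \<open>1 / (\<beta> * (1 + cosh s))\<close>, a multiple of the
  logistic density, because \<open>(1 + exp s)\<^sup>2 = 2 * exp s * (1 + cosh s)\<close>.\<close>

lemma integrable_abel_kernel_weighted:
  assumes "Re \<mu> < 1/2"
  shows "integrable (lborel \<Otimes>\<^sub>M lborel)
    (\<lambda>(s, x). (x + 1) powr (Re \<mu> - 3/2) * norm (abel_kernel \<mu> x s))"
proof -
  define \<beta> where "\<beta> = 1/2 - Re \<mu>"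
  define f where "f s x = (x + 1) powr (Re \<mu> - 3/2) * norm (abel_kernel \<mu> x s)" for s x
  have \<beta>: "\<beta> > 0" using assms by (simp add: \<beta>_def)
  have bi: "has_bochner_integral lborel (f s) (indicator {0<..} s * (1 / (\<beta> * (1 + cosh s))))" for s
  proof (cases "s > 0")
    case True
    have "1 + cosh s > 0" using cosh_real_pos[of s] by linarith
    moreover have "f s = (\<lambda>x. indicator {cosh s<..} x *
        ((x + 1) powr (- \<beta> - 1) * (x - cosh s) powr (\<beta> - 1)))"
      using True by (auto simp: f_def norm_abel_kernel \<beta>_def fun_eq_iff split: split_indicator)
    ultimately show ?thesis
      using True has_bochner_integral_beta_halfline[of 1 "cosh s" \<beta>] \<beta> by simp
  next
    case False
    then show ?thesis by (simp add: f_def[abs_def] norm_abel_kernel has_bochner_integral_zero)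
  qed
  have "integrable (lborel \<Otimes>\<^sub>M lborel) (case_prod f)"
  proof (rule lborel_pair.Fubini_integrable)
    show "case_prod f \<in> borel_measurable (lborel \<Otimes>\<^sub>M lborel)"
      unfolding f_def case_prod_unfold by measurable
    show "AE s in lborel. integrable lborel (\<lambda>x. case_prod f (s, x))"
      using bi by (simp add: has_bochner_integral_iff)
    have "\<bar>f s x\<bar> = f s x" for s x by (simp add: f_def)
    then have "(\<integral>x. norm (case_prod f (s, x)) \<partial>lborel) =
        2 / \<beta> * (indicator {0<..} s *\<^sub>R (exp s / (1 + exp s)\<^sup>2))" for s
    proof -
      have "1 / (\<beta> * (1 + cosh s)) = 2 / \<beta> * (exp s / (1 + exp s)\<^sup>2)"
      proof -
        have "(1 + exp s)\<^sup>2 = 2 * exp s * (1 + cosh s)"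
          by (simp add: cosh_field_def power2_eq_square exp_minus field_simps)
        moreover have "1 + cosh s \<noteq> 0" using cosh_real_pos[of s] by linarith
        ultimately show ?thesis using \<beta> by (simp add: divide_simps)
      qed
      then show ?thesis
        using bi[of s] by (simp add: has_bochner_integral_iff \<open>\<And>s x. \<bar>f s x\<bar> = f s x\<close>)
    qed
    moreover have "integrable lborel (\<lambda>s::real. indicator {0<..} s *\<^sub>R (exp s / (1 + exp s)\<^sup>2))"
      using has_bochner_integral_logistic_deriv
      by (intro integrable_mult_indicator) (auto simp: has_bochner_integral_iff)
    ultimately show "integrable lborel (\<lambda>s. \<integral>x. norm (case_prod f (s, x)) \<partial>lborel)"
      by (simp only: integrable_mult_right)
  qed
  then show ?thesis by (simp add: f_def[abs_def])
qed

text \<open>The preceding double integral read with \<open>s\<close> innermost. Up to constants,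
  this function dominates every term of the final series.\<close>

lemma integrable_abel_majorant_weighted:
  assumes "Re \<mu> < 1/2"
  shows "integrable lborel (\<lambda>x. (x + 1) powr (Re \<mu> - 3/2) * abel_majorant \<mu> x)"
  using lborel_pair.integrable_snd[OF integrable_abel_kernel_weighted[OF assms]]
  by (simp add: abel_majorant_def)

section \<open>Integration over x and t\<close>

lemma norm_of_real_powr_cosh_le:
  fixes t x :: real
  assumes "Re \<mu> < 1/2" "x > 1"
  shows "norm (complex_of_real (x + cosh t) powr (\<mu> - 3/2)) \<le> (x + 1) powr (Re \<mu> - 3/2)"
proof -
  have "norm (complex_of_real (x + cosh t) powr (\<mu> - 3/2)) = (x + cosh t) powr (Re \<mu> - 3/2)"
    using assms cosh_real_pos[of t] by (subst norm_powr_real_powr) (auto simp del: of_real_add)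
  also have "\<dots> \<le> (x + 1) powr (Re \<mu> - 3/2)"
    using assms cosh_real_ge_1[of t] by (intro powr_mono2') auto
  finally show ?thesis .
qed

text \<open>After exchanging the integrals over \<open>x\<close> and \<open>s\<close>, the inner one
  is the complex beta integral with \<open>b = cosh t\<close>, \<open>c = cosh s\<close>; with the
  factor \<open>sinh t\<close> the outer one is the Fourier integral computed above.\<close>

lemma integral_powr_abel_transform:
  fixes t y :: real
  assumes \<mu>: "Re \<mu> < 1/2" and "0 \<le> t" "y \<noteq> 0"
  shows "sinh t * (\<integral>x. of_real (x + cosh t) powr (\<mu> - 3/2) * abel_transform \<mu> y x \<partial>lborel) =
    of_real (pi * sin (y * t) / sinh (pi * y)) / (1/2 - \<mu>)"
proof -
  define \<beta> where "\<beta> = 1/2 - \<mu>"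
  have \<beta>: "Re \<beta> > 0" using \<mu> by (simp add: \<beta>_def)
  define f where "f s x = of_real (cos (y * s)) *
    (complex_of_real (x + cosh t) powr (\<mu> - 3/2) * abel_kernel \<mu> x s)" for s x
  have fi: "integrable (lborel \<Otimes>\<^sub>M lborel) (case_prod f)"
  proof (rule Bochner_Integration.integrable_bound[OF integrable_abel_kernel_weighted[OF \<mu>]])
    show "case_prod f \<in> borel_measurable (lborel \<Otimes>\<^sub>M lborel)"
      unfolding f_def case_prod_unfold by measurable
    have "norm (f s x) \<le> (x + 1) powr (Re \<mu> - 3/2) * norm (abel_kernel \<mu> x s)" for s x
    proof (cases "x > 1")
      case True
      have "norm (f s x) = \<bar>cos (y * s)\<bar> *
          (norm (complex_of_real (x + cosh t) powr (\<mu> - 3/2)) * norm (abel_kernel \<mu> x s))"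
        by (simp add: f_def norm_mult)
      also have "\<dots> \<le> 1 * ((x + 1) powr (Re \<mu> - 3/2) * norm (abel_kernel \<mu> x s))"
        by (intro mult_mono norm_of_real_powr_cosh_le[OF \<mu> True]) auto
      finally show ?thesis by simp
    next
      case False
      then show ?thesis by (simp add: f_def abel_kernel_eq_0)
    qed
    then show "AE p in lborel \<Otimes>\<^sub>M lborel. norm (case_prod f p) \<le>
        norm (case p of (s, x) \<Rightarrow> (x + 1) powr (Re \<mu> - 3/2) * norm (abel_kernel \<mu> x s))"
      by (auto simp: case_prod_unfold)
  qed
  have int_x: "(\<integral>x. f s x \<partial>lborel) =
      of_real (indicator {0<..} s * (cos (y * s) * (1 / (cosh t + cosh s)))) / \<beta>" for s
  proof (cases "s > 0")
    case True
    have pos: "cosh t + cosh s > 0" by (simp add: add_pos_pos)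
    have "f s x = of_real (cos (y * s)) * (indicator {cosh s<..} x *\<^sub>R
        (of_real (x + cosh t) powr (- \<beta> - 1) * of_real (x - cosh s) powr (\<beta> - 1)))" for x
      using True by (simp add: f_def abel_kernel_def \<beta>_def split: split_indicator)
    then have "(\<integral>x. f s x \<partial>lborel) = of_real (cos (y * s)) * (1 / (\<beta> * of_real (cosh t + cosh s)))"
      using has_bochner_integral_beta_halfline_complex[OF pos \<beta>]
      by (simp only: integral_mult_right_zero has_bochner_integral_iff)
    then show ?thesis using True by simp
  next
    case False
    then show ?thesis by (simp add: f_def abel_kernel_def)
  qed
  have "sinh t * (\<integral>x. of_real (x + cosh t) powr (\<mu> - 3/2) * abel_transform \<mu> y x \<partial>lborel) =
      sinh t * (\<integral>x. (\<integral>s. f s x \<partial>lborel) \<partial>lborel)"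
    by (simp add: f_def abel_transform_def mult.left_commute[of "complex_of_real (cos _)"])
  also have "(\<integral>x. (\<integral>s. f s x \<partial>lborel) \<partial>lborel) = (\<integral>s. (\<integral>x. f s x \<partial>lborel) \<partial>lborel)"
    by (rule lborel_pair.Fubini_integral[OF fi])
  also have "sinh t * \<dots> = of_real (sinh t *
      (\<integral>s. indicator {0<..} s * (cos (y * s) * (1 / (cosh t + cosh s))) \<partial>lborel)) / \<beta>"
    unfolding int_x by (subst integral_divide_zero) (simp only: integral_complex_of_real of_real_mult times_divide_eq_right)
  also have "sinh t * (\<integral>s. indicator {0<..} s * (cos (y * s) * (1 / (cosh t + cosh s))) \<partial>lborel) =
      (\<integral>s. indicator {0<..} s * (cos (y * s) * (sinh t / (cosh t + cosh s))) \<partial>lborel)"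
    by (subst integral_mult_right_zero[symmetric]) (simp add: mult_ac)
  also have "\<dots> = pi * sin (y * t) / sinh (pi * y)"
    using has_bochner_integral_cos_sinh_over_cosh[OF assms(2,3)] by (simp add: has_bochner_integral_iff)
  finally show ?thesis by (simp add: \<beta>_def)
qed

section \<open>Orthogonality of sines and integration by parts in \<open>t\<close>\<close>

lemma integral_sin_mult_sin:
  fixes m n :: nat
  assumes "m \<ge> 1" "n \<ge> 1"
  shows "(\<integral>t. indicator {0..pi} t * (sin (real n * t) * sin (real m * t)) \<partial>lborel) = (if n = m then pi / 2 else 0)"
proof -
  \<comment> \<open>The diagonal needs its own antiderivative because the frequency
    \<open>n - m\<close> vanishes there.\<close>
  define F where "F t = (if n = m then t / 2 - sin (2 * real n * t) / (4 * real n)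
    else sin ((real n - real m) * t) / (2 * (real n - real m)) - sin ((real n + real m) * t) / (2 * (real n + real m)))" for t
  have eq: "sin (real n * t) * sin (real m * t) = (cos ((real n - real m) * t) - cos ((real n + real m) * t)) / 2" for t
    by (simp add: left_diff_distrib distrib_right cos_diff cos_add)
  have s1: "sin ((real n - real m) * pi) = 0"
    using sin_npi_int[of "int n - int m"] by (simp add: mult.commute)
  have s2: "sin ((real n + real m) * pi) = 0"
    using sin_npi[of "n + m"] by simp
  have s3: "sin (2 * real n * pi) = 0"
    using sin_npi[of "2 * n"] by simp
  have "(\<integral>t. indicator {0..pi} t *\<^sub>R (sin (real n * t) * sin (real m * t)) \<partial>lborel) = F pi - F 0"
  proof (rule integral_FTC_Icc)
    fix t :: real
    have "(F has_real_derivative (cos ((real n - real m) * t) - cos ((real n + real m) * t)) / 2) (at t)"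
    proof (cases "n = m")
      case True
      then show ?thesis unfolding F_def using assms
        by (auto intro!: derivative_eq_intros simp: field_simps)
    next
      case False
      then have "real n - real m \<noteq> 0" "real n + real m \<noteq> 0" using assms by auto
      moreover have "((\<lambda>t. sin (p * t) / (2 * p) - sin (q * t) / (2 * q)) has_real_derivative
          (cos (p * t) - cos (q * t)) / 2) (at t)" if "p \<noteq> 0" "q \<noteq> 0" for p q :: real
        using that by (auto intro!: derivative_eq_intros simp: field_simps)
      ultimately show ?thesis unfolding F_def by (simp only: False if_False)
    qed
    then show "(F has_vector_derivative sin (real n * t) * sin (real m * t)) (at t within {0..pi})"
      unfolding eq by (simp add: has_real_derivative_iff_has_vector_derivative has_vector_derivative_at_within)
  qed (auto intro!: continuous_intros)
  then show ?thesis
    by (simp add: F_def s1 s2 s3)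
qed

text \<open>The boundary terms vanish since \<open>sin (n * t)\<close> is 0 at both 0 and
  \<open>pi\<close>.\<close>

lemma
  fixes \<mu> :: complex and x :: real and n :: nat
  assumes "x > 1" "n \<ge> 1"
  shows integrable_sin_sinh_powr: "integrable lborel (\<lambda>t. indicator {0..pi} t *\<^sub>R
       (of_real (sin (real n * t) * sinh t) * of_real (x + cosh t) powr (\<mu> - 3/2)))"
    and integral_cos_powr_by_parts:
     "integral {0..pi} (\<lambda>t. of_real (cos (real n * t)) * of_real (x + cosh t) powr (\<mu> - 1/2)) =
       (1/2 - \<mu>) / n * (\<integral>t. indicator {0..pi} t *\<^sub>R
       (of_real (sin (real n * t) * sinh t) * of_real (x + cosh t) powr (\<mu> - 3/2)) \<partial>lborel)"
proof -
  define g where "g t = complex_of_real (cos (real n * t)) * of_real (x + cosh t) powr (\<mu> - 1/2)" for t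
  define h where "h t = complex_of_real (sin (real n * t) * sinh t) * of_real (x + cosh t) powr (\<mu> - 3/2)" for t
  define G where "G t = complex_of_real (sin (real n * t) / n) * of_real (x + cosh t) powr (\<mu> - 1/2)" for t
  have pos: "x + cosh t > 0" for t :: real using assms(1) cosh_real_pos[of t] by linarith
  have nn: "complex_of_real x + of_real (cosh t) \<notin> \<real>\<^sub>\<le>\<^sub>0" for t
    using pos[of t] by (simp flip: of_real_add)
  have nz: "0 \<le> x + cosh t" "complex_of_real x + of_real (cosh t) \<noteq> 0" for t
    using pos[of t] nn[of t] by auto
  have gc: "continuous_on {0..pi} g" unfolding g_def using nn nz by (auto intro!: continuous_intros)
  have hc: "continuous_on {0..pi} h" unfolding h_def using nn nz by (auto intro!: continuous_intros)
  have "set_integrable lborel {0..pi} h" by (rule borel_integrable_atLeastAtMost'[OF hc])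
  then show "integrable lborel (\<lambda>t. indicator {0..pi} t *\<^sub>R
       (of_real (sin (real n * t) * sinh t) * of_real (x + cosh t) powr (\<mu> - 3/2)))"
    by (simp add: set_integrable_def h_def)
  have hb: "integral {0..pi} h = (\<integral>t. indicator {0..pi} t *\<^sub>R h t \<partial>lborel)"
    using set_borel_integral_eq_integral(2)[OF \<open>set_integrable lborel {0..pi} h\<close>]
    by (simp add: set_lebesgue_integral_def)
  have G': "(G has_vector_derivative (g t - (1/2 - \<mu>) / n * h t)) (at t within {0..pi})" for t
  proof -
    have 1: "((\<lambda>t. complex_of_real (sin (real n * t) / n)) has_vector_derivative of_real (cos (real n * t))) (at t within {0..pi})"
      using assms(2) by (intro has_vector_derivative_of_real) (auto intro!: derivative_eq_intros
        simp flip: has_real_derivative_iff_has_vector_derivative)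
    have 2: "((\<lambda>t. complex_of_real (x + cosh t)) has_vector_derivative of_real (sinh t)) (at t within {0..pi})"
      by (intro has_vector_derivative_of_real) (auto intro!: derivative_eq_intros
        simp flip: has_real_derivative_iff_has_vector_derivative)
    have "((\<lambda>z. z powr (\<mu> - 1/2)) has_field_derivative
        (\<mu> - 1/2) * of_real (x + cosh t) powr (\<mu> - 1/2 - 1)) (at (complex_of_real (x + cosh t)))"
      using nn[of t] by (intro has_field_derivative_powr) simp
    from field_vector_diff_chain_within[OF 2 has_field_derivative_at_within[OF this]]
    have 3: "((\<lambda>t. complex_of_real (x + cosh t) powr (\<mu> - 1/2)) has_vector_derivative
        of_real (sinh t) * ((\<mu> - 1/2) * of_real (x + cosh t) powr (\<mu> - 1/2 - 1))) (at t within {0..pi})"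
      by (simp add: o_def)
    have "((\<lambda>t. complex_of_real (sin (real n * t) / n) * of_real (x + cosh t) powr (\<mu> - 1/2)) has_vector_derivative
        of_real (sin (real n * t) / n) * (of_real (sinh t) * ((\<mu> - 1/2) * of_real (x + cosh t) powr (\<mu> - 1/2 - 1))) +
        of_real (cos (real n * t)) * of_real (x + cosh t) powr (\<mu> - 1/2)) (at t within {0..pi})"
      by (rule has_vector_derivative_mult[OF 1 3])
    also have "of_real (sin (real n * t) / n) * (of_real (sinh t) * ((\<mu> - 1/2) * of_real (x + cosh t) powr (\<mu> - 1/2 - 1))) +
        of_real (cos (real n * t)) * of_real (x + cosh t) powr (\<mu> - 1/2) = g t - (1/2 - \<mu>) / n * h t"
      using assms(2) by (simp add: g_def h_def field_simps)
    finally show ?thesis unfolding G_def .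
  qed
  have "((\<lambda>t. g t - (1/2 - \<mu>) / n * h t) has_integral (G pi - G 0)) {0..pi}"
    by (rule fundamental_theorem_of_calculus[OF _ G']) auto
  then have "integral {0..pi} (\<lambda>t. g t - (1/2 - \<mu>) / n * h t) = 0"
    by (simp add: G_def has_integral_iff)
  moreover have "integral {0..pi} (\<lambda>t. g t - (1/2 - \<mu>) / n * h t) =
      integral {0..pi} g - (1/2 - \<mu>) / n * integral {0..pi} h"
    using gc hc assms(2) by (subst integral_diff) (auto intro!: integrable_continuous_interval continuous_intros)
  ultimately show "integral {0..pi} (\<lambda>t. of_real (cos (real n * t)) * of_real (x + cosh t) powr (\<mu> - 1/2)) =
       (1/2 - \<mu>) / n * (\<integral>t. indicator {0..pi} t *\<^sub>R
       (of_real (sin (real n * t) * sinh t) * of_real (x + cosh t) powr (\<mu> - 3/2)) \<partial>lborel)"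
    by (simp add: hb g_def[abs_def] h_def)
qed

section \<open>The incomplete integral: decay in \<open>x\<close> and pairing with the Abel
  transform\<close>

definition inc_integral :: "complex \<Rightarrow> nat \<Rightarrow> real \<Rightarrow> complex" where
  "inc_integral \<mu> n x = integral {0..pi} (\<lambda>t. of_real (cos (real n * t)) * of_real (x + cosh t) powr (\<mu> - 1/2))"

text \<open>The integrand left after integration by parts, without the constant
  \<open>(1/2 - \<mu>) / n\<close> and extended by zero in \<open>t\<close>.\<close>

definition inc_kernel :: "complex \<Rightarrow> nat \<Rightarrow> real \<Rightarrow> real \<Rightarrow> complex" where
  "inc_kernel \<mu> n t x = indicator {0..pi} t *\<^sub>R
     (of_real (sin (real n * t) * sinh t) * of_real (x + cosh t) powr (\<mu> - 3/2))"

lemma measurable_inc_kernel [measurable (raw)]: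
  assumes [measurable]: "f \<in> borel_measurable M" "g \<in> borel_measurable M"
  shows "(\<lambda>z. inc_kernel \<mu> n (f z) (g z)) \<in> borel_measurable M"
  unfolding inc_kernel_def by measurable

lemma inc_integral_by_parts:
  assumes "x > 1" "n \<ge> 1"
  shows "inc_integral \<mu> n x = (1/2 - \<mu>) / n * (\<integral>t. inc_kernel \<mu> n t x \<partial>lborel)"
  using integral_cos_powr_by_parts[OF assms] by (simp only: inc_integral_def inc_kernel_def)

lemma norm_inc_kernel_le:
  assumes "Re \<mu> < 1/2" "x > 1"
  shows "norm (inc_kernel \<mu> n t x) \<le> indicator {0..pi} t * (sinh pi * (x + 1) powr (Re \<mu> - 3/2))"
proof (cases "t \<in> {0..pi}")
  case True
  have "norm (inc_kernel \<mu> n t x) =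
      \<bar>sin (real n * t)\<bar> * sinh t * norm (complex_of_real (x + cosh t) powr (\<mu> - 3/2))"
    using True by (simp add: inc_kernel_def norm_mult abs_mult)
  also have "\<dots> \<le> 1 * sinh pi * (x + 1) powr (Re \<mu> - 3/2)"
    using True by (intro mult_mono norm_of_real_powr_cosh_le assms) auto
  finally show ?thesis using True by simp
qed (simp add: inc_kernel_def)

text \<open>Estimating after integration by parts gains one power of \<open>x\<close> over the
  direct estimate; this is exactly the weight that makes \<open>abel_majorant\<close>
  integrable.\<close>

lemma norm_inc_integral_le:
  assumes "Re \<mu> < 1/2" "x > 1" "n \<ge> 1"
  shows "norm (inc_integral \<mu> n x) \<le>
    norm (1/2 - \<mu>) / n * (pi * sinh pi) * (x + 1) powr (Re \<mu> - 3/2)"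
proof -
  have i: "integrable lborel (\<lambda>t. inc_kernel \<mu> n t x)"
    using integrable_sin_sinh_powr[OF assms(2,3)] by (simp only: inc_kernel_def)
  have "norm (\<integral>t. inc_kernel \<mu> n t x \<partial>lborel) \<le>
      (\<integral>t. indicator {0..pi} t * (sinh pi * (x + 1) powr (Re \<mu> - 3/2)) \<partial>lborel)"
    using i by (intro order_trans[OF integral_norm_bound] integral_mono norm_inc_kernel_le assms)
      (auto intro!: integrable_mult_left)
  also have "\<dots> = pi * sinh pi * (x + 1) powr (Re \<mu> - 3/2)"
    by simp
  finally have "norm (\<integral>t. inc_kernel \<mu> n t x \<partial>lborel) \<le> pi * sinh pi * (x + 1) powr (Re \<mu> - 3/2)" .
  then have "norm (1/2 - \<mu>) / n * norm (\<integral>t. inc_kernel \<mu> n t x \<partial>lborel) \<le>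
      norm (1/2 - \<mu>) / n * (pi * sinh pi * (x + 1) powr (Re \<mu> - 3/2))"
    by (intro mult_left_mono) auto
  then show ?thesis
    by (simp add: inc_integral_by_parts[OF assms(2,3)] norm_mult norm_divide mult.assoc)
qed

text \<open>Exchanging \<open>t\<close> and \<open>x\<close> leaves the integral of
  \<open>sin (n * t) * sin (m * t)\<close>. The factor \<open>1/2 - \<mu>\<close> from integration
  by parts cancels the one from the beta integral.\<close>

lemma integral_inc_integral_abel_transform:
  fixes m n :: nat
  assumes \<mu>: "Re \<mu> < 1/2" and m: "m \<ge> 1" and n: "n \<ge> 1"
  shows "(\<integral>x. indicator {1<..} x *\<^sub>R (inc_integral \<mu> n x * abel_transform \<mu> m x) \<partial>lborel) =
    of_real (if n = m then pi\<^sup>2 / (2 * n * sinh (pi * n)) else 0)"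
proof -
  define \<beta> where "\<beta> = 1/2 - \<mu>"
  have \<beta>: "\<beta> \<noteq> 0" using \<mu> by (auto simp: \<beta>_def complex_eq_iff)
  define M where "M x = (x + 1) powr (Re \<mu> - 3/2) * abel_majorant \<mu> x" for x
  have M: "integrable lborel M" "M x \<ge> 0" for x
    using integrable_abel_majorant_weighted[OF \<mu>] by (simp_all add: M_def[abs_def] abel_majorant_nonneg)
  have [measurable]: "M \<in> borel_measurable borel" unfolding M_def by measurable
  define f where "f t x = inc_kernel \<mu> n t x * abel_transform \<mu> m x" for t x
  have fi: "integrable (lborel \<Otimes>\<^sub>M lborel) (case_prod f)"
  proof (rule Bochner_Integration.integrable_bound)
    show "integrable (lborel \<Otimes>\<^sub>M lborel) (\<lambda>(t, x). indicator {0..pi} t * sinh pi * M x)"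
      by (rule lborel_pair.Fubini_integrable)
         (auto simp: case_prod_unfold abs_mult M intro!: integrable_mult_left integrable_mult_right)
    show "case_prod f \<in> borel_measurable (lborel \<Otimes>\<^sub>M lborel)"
      unfolding f_def case_prod_unfold by measurable
    have "norm (f t x) \<le> indicator {0..pi} t * sinh pi * M x" for t x
    proof (cases "x > 1")
      case True
      have "norm (f t x) \<le> indicator {0..pi} t * (sinh pi * (x + 1) powr (Re \<mu> - 3/2)) * abel_majorant \<mu> x"
        unfolding f_def norm_mult
        by (intro mult_mono norm_inc_kernel_le norm_abel_transform_le \<mu> True) auto
      then show ?thesis by (simp add: M_def mult_ac)
    next
      case False
      then show ?thesis using M(2)[of x] by (simp add: f_def abel_transform_eq_0)
    qed
    then show "AE p in lborel \<Otimes>\<^sub>M lborel. norm (case_prod f p) \<le>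
        norm (case p of (t, x) \<Rightarrow> indicator {0..pi} t * sinh pi * M x)"
      by (auto simp: case_prod_unfold intro: order_trans[OF _ abs_ge_self])
  qed
  have int_x: "(\<integral>x. f t x \<partial>lborel) =
      of_real (pi / sinh (pi * m)) / \<beta> * of_real (indicator {0..pi} t * (sin (real n * t) * sin (real m * t)))" for t
  proof (cases "t \<in> {0..pi}")
    case True
    have "f t x = of_real (sin (real n * t)) * (of_real (sinh t) *
        (of_real (x + cosh t) powr (\<mu> - 3/2) * abel_transform \<mu> m x))" for x
      using True by (simp add: f_def inc_kernel_def mult_ac)
    then have "(\<integral>x. f t x \<partial>lborel) = of_real (sin (real n * t)) *
        (of_real (sinh t) * (\<integral>x. of_real (x + cosh t) powr (\<mu> - 3/2) * abel_transform \<mu> m x \<partial>lborel))"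
      by (simp only: integral_mult_right_zero)
    also have "\<dots> = of_real (sin (real n * t)) * (of_real (pi * sin (m * t) / sinh (pi * m)) / (1/2 - \<mu>))"
      using integral_powr_abel_transform[OF \<mu>, of t "real m"] True m by simp
    finally show ?thesis using True by (simp add: \<beta>_def)
  next
    case False
    then show ?thesis by (simp add: f_def inc_kernel_def)
  qed
  \<comment> \<open>The indicator is absorbed because \<open>abel_transform\<close> vanishes for
    \<open>x \<le> 1\<close>.\<close>
  have "(\<integral>x. indicator {1<..} x *\<^sub>R (inc_integral \<mu> n x * abel_transform \<mu> m x) \<partial>lborel) =
      (\<integral>x. \<beta> / n * (\<integral>t. f t x \<partial>lborel) \<partial>lborel)"
  proof (rule Bochner_Integration.integral_cong[OF refl])
    fix x :: real
    show "indicator {1<..} x *\<^sub>R (inc_integral \<mu> n x * abel_transform \<mu> m x) = \<beta> / n * (\<integral>t. f t x \<partial>lborel)"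
    proof (cases "x > 1")
      case True
      then show ?thesis by (simp add: inc_integral_by_parts[OF True n] f_def \<beta>_def)
    next
      case False
      then show ?thesis by (simp add: f_def abel_transform_eq_0)
    qed
  qed
  also have "\<dots> = \<beta> / n * (\<integral>t. (\<integral>x. f t x \<partial>lborel) \<partial>lborel)"
    by (simp add: lborel_pair.Fubini_integral[OF fi])
  also have "(\<integral>t. (\<integral>x. f t x \<partial>lborel) \<partial>lborel) =
      of_real (pi / sinh (pi * m)) / \<beta> * of_real (if n = m then pi / 2 else 0)"
    unfolding int_x
    by (subst integral_mult_right_zero) (simp only: integral_complex_of_real integral_sin_mult_sin[OF m n])
  finally show ?thesis
    using \<beta> by (simp add: power2_eq_square)
qed

section \<open>Conical functions\<close>

text \<open>On the conical line \<open>\<nu> + 1/2 = \<i> * m\<close>, so the hyperbolic cosine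
  becomes \<open>cos (m * t)\<close>.\<close>

lemma legendreP_conical_eq:
  fixes m :: nat
  assumes "Re \<mu> < 1/2" "x > 1"
  shows "legendreP \<mu> (\<i> * of_nat m - 1/2) x =
    of_real (sqrt (2 / pi)) * of_real (sinh (arcosh x)) powr \<mu> / Gamma (1/2 - \<mu>) * abel_transform \<mu> m x"
proof -
  define \<alpha> where "\<alpha> = arcosh x"
  have \<alpha>: "\<alpha> > 0" "cosh \<alpha> = x" using assms by (simp_all add: \<alpha>_def)
  define g where "g s = of_real (cos (real m * s)) * abel_kernel \<mu> x s" for s
  have gi: "integrable lborel g"
    by (rule Bochner_Integration.integrable_bound[OF integrable_abel_kernel[OF assms]])
       (auto simp: g_def[abs_def] norm_mult mult_left_le_one_le)
  have gind: "indicator {0..\<alpha>} s *\<^sub>R g s = g s" for s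
    using cosh_real_nonneg_less_iff[of s \<alpha>] \<alpha> by (auto simp: g_def abel_kernel_def split: split_indicator)
  have si: "set_integrable lborel {0..\<alpha>} g"
    using gi by (simp add: set_integrable_def gind)
  have "integral {0..\<alpha>} (\<lambda>t. cosh (complex_of_real t * (\<i> * of_nat m - 1/2 + 1/2)) /
      (complex_of_real (cosh \<alpha> - cosh t)) powr (1/2 + \<mu>)) = integral {0..\<alpha>} g"
  \<comment> \<open>The integrands disagree at \<open>t = 0\<close>, where the kernel is 0 by
    definition; both endpoints are discarded as a null set.\<close>
  proof (rule integral_spike[of "{0, \<alpha>}"])
    show "negligible {0, \<alpha>}" by (simp add: negligible_insert)
    fix t assume "t \<in> {0..\<alpha>} - {0, \<alpha>}"
    then have t: "0 < t" "t < \<alpha>" by auto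
    have "cosh t < x" using cosh_real_nonneg_less_iff[of t \<alpha>] \<alpha> t by simp
    moreover have "cosh (complex_of_real t * (\<i> * of_nat m - 1/2 + 1/2)) = of_real (cos (real m * t))"
      by (simp add: cosh_conv_cos algebra_simps flip: cos_of_real)
    moreover have "- 1/2 - \<mu> = - (1/2 + \<mu>)" by simp
    ultimately show "g t = cosh (complex_of_real t * (\<i> * of_nat m - 1/2 + 1/2)) /
      (complex_of_real (cosh \<alpha> - cosh t)) powr (1/2 + \<mu>)"
      using t \<alpha> by (simp only: g_def abel_kernel_def powr_minus divide_inverse simp_thms if_True)
  qed
  also have "\<dots> = abel_transform \<mu> m x"
    using set_borel_integral_eq_integral(2)[OF si, symmetric]
    by (simp only: set_lebesgue_integral_def gind) (simp only: abel_transform_def g_def)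
  finally show ?thesis
    by (simp only: legendreP_def Let_def \<alpha>_def)
qed

lemma legendreP_inc_conical_eq:
  fixes n :: nat
  shows "legendreP_inc \<mu> (\<i> * of_nat n - 1/2) x pi =
    of_real (sqrt (2 / pi)) * Gamma (1/2 - \<mu>) * of_real (x\<^sup>2 - 1) powr (- \<mu> / 2)
      / (Gamma (1/2 + \<i> * of_nat n - \<mu>) * Gamma (1/2 - \<i> * of_nat n - \<mu>)) * inc_integral \<mu> n x"
proof -
  have "cosh (complex_of_real t * (\<i> * of_nat n - 1/2 + 1/2)) / of_real (cosh t + x) powr (1/2 - \<mu>) =
      of_real (cos (real n * t)) * of_real (x + cosh t) powr (\<mu> - 1/2)" for t
  proof -
    have "cosh (complex_of_real t * (\<i> * of_nat n - 1/2 + 1/2)) = of_real (cos (real n * t))"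
      by (simp add: cosh_conv_cos algebra_simps flip: cos_of_real)
    moreover have "\<mu> - 1/2 = - (1/2 - \<mu>)" by simp
    ultimately show ?thesis
      by (simp only: powr_minus divide_inverse add.commute[of x])
  qed
  moreover have "1 + (\<i> * of_nat n - 1/2) - \<mu> = 1/2 + \<i> * of_nat n - \<mu>"
    "- (\<i> * of_nat n - 1/2) - \<mu> = 1/2 - \<i> * of_nat n - \<mu>" by simp_all
  ultimately show ?thesis
    by (simp only: legendreP_inc_def inc_integral_def)
qed

text \<open>\<open>Gamma\<close> takes the value 0 only by convention at its poles, the nonpositive
  integers.\<close>

lemma Gamma_nonzero_of_Re_pos: "Re z > 0 \<Longrightarrow> Gamma z \<noteq> 0"
  by (auto simp: Gamma_eq_zero_iff elim!: nonpos_Ints_cases)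

text \<open>Since \<open>sinh (arcosh x)\<close> is the square root of \<open>x\<^sup>2 - 1\<close>,
  the powers cancel, as do the factors \<open>Gamma (1/2 - \<mu>)\<close>.\<close>

lemma legendreP_inc_mult_legendreP:
  fixes m n :: nat
  assumes "Re \<mu> < 1/2" "x > 1"
  shows "legendreP_inc \<mu> (\<i> * of_nat n - 1/2) x pi * legendreP \<mu> (\<i> * of_nat m - 1/2) x =
    of_real (2 / pi) / (Gamma (1/2 + \<i> * of_nat n - \<mu>) * Gamma (1/2 - \<i> * of_nat n - \<mu>)) *
      (inc_integral \<mu> n x * abel_transform \<mu> m x)"
proof -
  define S where "S = sqrt (x\<^sup>2 - 1)"
  have x2: "x\<^sup>2 - 1 > 0" using assms by (simp add: power2_eq_square less_1_mult)
  have S: "S > 0" "x\<^sup>2 - 1 = S\<^sup>2" "sinh (arcosh x) = S"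
    using x2 assms by (simp_all add: S_def sinh_arcosh_real)
  \<comment> \<open>For positive bases the principal powers reduce to real logarithms, so the
    cancellation involves no branch ambiguity.\<close>
  have "ln (S\<^sup>2) = 2 * ln S" using S by (simp add: ln_realpow)
  then have one: "of_real (x\<^sup>2 - 1) powr (- \<mu> / 2) * complex_of_real (sinh (arcosh x)) powr \<mu> = 1"
    using S(1) unfolding S(2,3)
    by (simp add: powr_def Ln_of_real flip: exp_add of_real_power)
  have G: "Gamma (1/2 - \<mu>) \<noteq> 0"
    using assms by (intro Gamma_nonzero_of_Re_pos) simp
  have sq: "complex_of_real (sqrt (2 / pi)) * of_real (sqrt (2 / pi)) = of_real (2 / pi)"
    by (simp flip: of_real_mult)
  have "legendreP_inc \<mu> (\<i> * of_nat n - 1/2) x pi * legendreP \<mu> (\<i> * of_nat m - 1/2) x =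
     (of_real (sqrt (2 / pi)) * of_real (sqrt (2 / pi))) * (Gamma (1/2 - \<mu>) / Gamma (1/2 - \<mu>)) *
     (of_real (x\<^sup>2 - 1) powr (- \<mu> / 2) * of_real (sinh (arcosh x)) powr \<mu>) /
     (Gamma (1/2 + \<i> * of_nat n - \<mu>) * Gamma (1/2 - \<i> * of_nat n - \<mu>)) *
      (inc_integral \<mu> n x * abel_transform \<mu> m x)"
    unfolding legendreP_inc_conical_eq legendreP_conical_eq[OF assms]
    by (simp only: divide_inverse inverse_mult_distrib mult_ac)
  then show ?thesis by (simp only: one sq divide_self[OF G] mult_1_right)
qed

text \<open>Summation and integration are exchanged by dominated termwise integration: the term of
  index \<open>m\<close> is bounded by \<open>norm (a (Suc m))\<close> times one fixed integrable
  function, and only the term with \<open>Suc m = n\<close> has a nonzero kernel integral.\<close>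

theorem theorem1:
  fixes \<mu> :: complex and a :: "nat \<Rightarrow> complex" and n :: nat
  assumes "Re \<mu> < 1/2"
    and "summable (\<lambda>m. norm (a (Suc m)))"
    and "n \<ge> 1"
  shows "(\<forall>x>1. summable (\<lambda>m. norm (a (Suc m) * legendreP \<mu> (\<i> * of_nat (Suc m) - 1/2) x)))
     \<and> set_integrable lborel {1<..}
         (\<lambda>x. norm (legendreP_inc \<mu> (\<i> * of_nat n - 1/2) x pi) *
              (\<Sum>m. norm (a (Suc m) * legendreP \<mu> (\<i> * of_nat (Suc m) - 1/2) x)))
     \<and> a n = complex_of_real (real n / pi * sinh (pi * real n))
             * Gamma (1/2 + \<i> * of_nat n - \<mu>) * Gamma (1/2 - \<i> * of_nat n - \<mu>)
             * (LINT x:{1<..}|lborel. legendreP_inc \<mu> (\<i> * of_nat n - 1/2) x pi *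
                  (\<Sum>m. a (Suc m) * legendreP \<mu> (\<i> * of_nat (Suc m) - 1/2) x))"
proof -
  define Q where "Q = legendreP_inc \<mu> (\<i> * of_nat n - 1/2)"
  define P where "P m = legendreP \<mu> (\<i> * of_nat (Suc m) - 1/2)" for m
  define D where "D = Gamma (1/2 + \<i> * of_nat n - \<mu>) * Gamma (1/2 - \<i> * of_nat n - \<mu>)"
  define c where "c = of_real (2 / pi) / D"
  define M where "M x = (x + 1) powr (Re \<mu> - 3/2) * abel_majorant \<mu> x" for x
  define f where "f m x = indicator {1<..} x *\<^sub>R (Q x pi * (a (Suc m) * P m x))" for m x
  note \<mu> = assms(1)
  have D: "D \<noteq> 0"
    using \<mu> by (simp add: D_def Gamma_nonzero_of_Re_pos)
  have M: "integrable lborel M" "M x \<ge> 0" for x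
    using integrable_abel_majorant_weighted[OF \<mu>] by (simp_all add: M_def[abs_def] abel_majorant_nonneg)
  have feq: "f m x = c * a (Suc m) * (indicator {1<..} x *\<^sub>R (inc_integral \<mu> n x * abel_transform \<mu> (Suc m) x))" for m x
    using legendreP_inc_mult_legendreP[OF \<mu>, of x n "Suc m"]
    by (cases "x > 1") (simp_all add: f_def Q_def P_def c_def D_def mult_ac)
  have summ: "summable (\<lambda>m. norm (a (Suc m) * P m x))" if x: "x > 1" for x
  proof -
    \<comment> \<open>\<open>K\<close> depends on \<open>x\<close> but not on \<open>m\<close>,
      because the majorant is uniform in the frequency.\<close>
    define K where "K = norm (of_real (sqrt (2 / pi)) * of_real (sinh (arcosh x)) powr \<mu> / Gamma (1/2 - \<mu>)) *
      abel_majorant \<mu> x"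
    have "norm (a (Suc m) * P m x) \<le> norm (a (Suc m)) * K" for m
      unfolding P_def legendreP_conical_eq[OF \<mu> x] K_def norm_mult[of "a (Suc m)"]
      unfolding norm_mult[of _ "abel_transform \<mu> (Suc m) x"]
      by (intro mult_left_mono norm_abel_transform_le \<mu> x) auto
    then show ?thesis
      by (intro summable_comparison_test'[OF summable_mult2[OF assms(2), of K]]) simp
  qed
  \<comment> \<open>Collects the Gamma prefactor and the constant of the decay estimate for
    \<open>inc_integral\<close>.\<close>
  define C where "C = norm c * (norm (1/2 - \<mu>) / n * (pi * sinh pi))"
  have bound: "norm (f m x) \<le> norm (a (Suc m)) * (C * M x)" for m x
  proof (cases "x > 1")
    case True
    have "norm (inc_integral \<mu> n x) * norm (abel_transform \<mu> (Suc m) x) \<le>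
       norm (1/2 - \<mu>) / n * (pi * sinh pi) * (x + 1) powr (Re \<mu> - 3/2) * abel_majorant \<mu> x"
      using assms(3) by (intro mult_mono norm_inc_integral_le norm_abel_transform_le \<mu> True) auto
    then have "norm (c * a (Suc m)) * (norm (inc_integral \<mu> n x) * norm (abel_transform \<mu> (Suc m) x)) \<le>
       norm (c * a (Suc m)) * (norm (1/2 - \<mu>) / n * (pi * sinh pi) * (x + 1) powr (Re \<mu> - 3/2) * abel_majorant \<mu> x)"
      by (intro mult_left_mono) auto
    then show ?thesis
      using True by (simp add: feq norm_mult C_def M_def mult_ac)
  next
    case False
    then show ?thesis using M(2)[of x] by (simp add: f_def C_def)
  qed
  have CM: "integrable lborel (\<lambda>x. norm (a (Suc m)) * (C * M x))" for m
    using M by simp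
  have fint: "integrable lborel (f m)" for m
  proof (rule Bochner_Integration.integrable_bound[OF CM])
    \<comment> \<open>Measurability in \<open>x\<close> is read off from the form after integration
      by parts, where a gauge integral has been replaced by a Lebesgue integral with a jointly
      measurable integrand.\<close>
    have "f m x = c * a (Suc m) * (indicator {1<..} x *\<^sub>R
        (((1/2 - \<mu>) / n * (\<integral>t. inc_kernel \<mu> n t x \<partial>lborel)) * abel_transform \<mu> (Suc m) x))" for x
      using inc_integral_by_parts[of x n \<mu>] assms(3) by (cases "x > 1") (simp_all add: feq)
    then have "f m = (\<lambda>x. c * a (Suc m) * (indicator {1<..} x *\<^sub>R
        (((1/2 - \<mu>) / n * (\<integral>t. inc_kernel \<mu> n t x \<partial>lborel)) * abel_transform \<mu> (Suc m) x)))"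
      by (rule ext)
    then show "f m \<in> borel_measurable lborel" by simp
    show "AE x in lborel. norm (f m x) \<le> norm (norm (a (Suc m)) * (C * M x))"
      using bound by (auto intro: order_trans[OF _ abs_ge_self])
  qed
  have fsum: "summable (\<lambda>m. norm (f m x))" for x
    using assms(2) bound
    by (intro summable_comparison_test'[OF summable_mult2[OF assms(2), of "C * M x"]]) simp
  have fisum: "summable (\<lambda>m. \<integral>x. norm (f m x) \<partial>lborel)"
  proof (rule summable_comparison_test'[OF summable_mult2[OF assms(2), of "C * (\<integral>x. M x \<partial>lborel)"]])
    fix m
    have "(\<integral>x. norm (f m x) \<partial>lborel) \<le> (\<integral>x. norm (a (Suc m)) * (C * M x) \<partial>lborel)"
      using fint CM bound by (intro integral_mono) auto
    then show "norm (\<integral>x. norm (f m x) \<partial>lborel) \<le> norm (a (Suc m)) * (C * (\<integral>x. M x \<partial>lborel))"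
      by simp
  qed
  have "integrable lborel (\<lambda>x. \<Sum>m. norm (f m x))"
    by (rule integrable_suminf) (use fint fsum fisum in auto)
  moreover have "(\<Sum>m. norm (f m x)) = indicator {1<..} x *\<^sub>R (norm (Q x pi) * (\<Sum>m. norm (a (Suc m) * P m x)))" for x
    using suminf_mult[OF summ, of x "norm (Q x pi)"] by (cases "x > 1") (simp_all add: f_def norm_mult)
  ultimately have part2: "set_integrable lborel {1<..} (\<lambda>x. norm (Q x pi) * (\<Sum>m. norm (a (Suc m) * P m x)))"
    by (simp add: set_integrable_def)
  \<comment> \<open>The constant is \<open>c = 2 / (pi * D)\<close> times
    \<open>pi\<^sup>2 / (2 * n * sinh (pi * n))\<close>. As \<open>n \<ge> 1\<close>, the index
    \<open>n - 1\<close> is a true predecessor and \<open>Suc m = n\<close> holds there.\<close>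
  have fval: "(\<integral>x. f m x \<partial>lborel) =
      (if m = n - 1 then a n * (of_real pi / (D * of_real (n * sinh (pi * n)))) else 0)" for m
  proof -
    have "(\<integral>x. f m x \<partial>lborel) = c * a (Suc m) *
        of_real (if n = Suc m then pi\<^sup>2 / (2 * n * sinh (pi * n)) else 0)"
      unfolding feq by (subst integral_mult_right_zero)
        (use integral_inc_integral_abel_transform[OF \<mu>, of "Suc m" n] assms(3) in \<open>simp only: le_add1 Suc_le_mono le0 One_nat_def simp_thms\<close>)
    moreover have "n = Suc m \<longleftrightarrow> m = n - 1" using assms(3) by auto
    ultimately show ?thesis
      by (auto simp: c_def power2_eq_square)
  qed
  have "(\<integral>x. (\<Sum>m. f m x) \<partial>lborel) = (\<Sum>m. (\<integral>x. f m x \<partial>lborel))"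
    by (rule integral_suminf) (use fint fsum fisum in auto)
  also have "\<dots> = a n * (of_real pi / (D * of_real (n * sinh (pi * n))))"
    unfolding fval by (rule sums_unique[symmetric]) (rule sums_single)
  finally have "(\<integral>x. (\<Sum>m. f m x) \<partial>lborel) = a n * (of_real pi / (D * of_real (n * sinh (pi * n))))" .
  moreover have "(\<Sum>m. f m x) = indicator {1<..} x *\<^sub>R (Q x pi * (\<Sum>m. a (Suc m) * P m x))" for x
    using suminf_mult[OF summable_norm_cancel[OF summ], of x "Q x pi"] by (cases "x > 1") (simp_all add: f_def)
  ultimately have "(LINT x:{1<..}|lborel. Q x pi * (\<Sum>m. a (Suc m) * P m x)) =
      a n * (of_real pi / (D * of_real (n * sinh (pi * n))))"
    by (simp add: set_lebesgue_integral_def)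
  then have "a n = of_real (real n / pi * sinh (pi * real n)) * D *
      (LINT x:{1<..}|lborel. Q x pi * (\<Sum>m. a (Suc m) * P m x))"
    using D assms(3) by simp
  with summ part2 show ?thesis
    by (simp only: Q_def P_def D_def mult.assoc) blast
qed

end
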